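(* The estimator $\hat u=X=(X_t)_{t\in[0,T]}$ of the drift is minimax: for all $u\in\Omega$, $$\mathrm{R}(\gamma,\mu,\hat u)=\mathbb{E}_u\left[\int_0^T|X_t-u_t|^2\mu(dt)\right]=\inf_\xi\sup_{v\in\Omega}\mathbb{E}_v\left[\int_0^T|\xi_t-v_t|^2\mu(dt)\right],$$ where the infimum is over all estimators $\xi=(\xi_t)_{t\in[0,T]}$ (with no adaptedness or unbiasedness condition) and $\mathrm{R}(\gamma,\mu,\hat u)=\int_0^T\langle\chi_t,\Gamma\chi_t\rangle\mu(dt)=\int_0^T\gamma(t,t)\mu(dt)$.
   Context: Let $T>0$, let $\mu$ be a finite Borel measure on $[0,T]$, $\chi_t(s)=\min(s,t)$ for $s,t\in[0,T]$, and $\langle h,g\rangle=\langle\dot h,\dot g\rangle_{L^2([0,T],dt)}$ for absolutely continuous $h,g$ vanishing at $0$. Let $\gamma(s,t)=\int_0^{s\wedge t}K(t,r)K(s,r)dr$ be the covariance function of a centered Gaussian process, given by a deterministic kernel $K$; let $(Kh)(t)=\int_0^tK(t,s)\dot h(s)ds$ (assumed differentiable in $t$), let $K^*$ be the adjoint of $K$ with respect to $\langle\cdot,\cdot\rangle$, and let $\Gamma=KK^*$, so that $\langle\chi_t,\Gamma\chi_s\rangle=\gamma(s,t)$. $\Omega$ is the space of (continuous) paths on $[0,T]$ with coordinate process $(X_t)_{t\in[0,T]}$. For $v\in\Omega$, $\mathbb{P}_v$ (expectation $\mathbb{E}_v$) is the law on $\Omega$ under which $(X_t-v_t)_{t\in[0,T]}$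 is a centered Gaussian process with covariance function $\gamma$. An estimator is any jointly measurable process $(\xi_t)_{t\in[0,T]}$ that is a functional of the observed path $X$. It is a standing assumption that $\int_0^T\gamma(t,t)\mu(dt)<\infty$. *)

theory Defs
  imports "HOL-Probability.Probability"
begin

section \<open>Absolutely continuous functions and the pairing of derivatives\<close>

definition square_integrable :: "real \<Rightarrow> (real \<Rightarrow> real) \<Rightarrow> bool" where
  "square_integrable a f \<longleftrightarrow>
     f \<in> borel_measurable (lebesgue_on {0..a}) \<and> integrable (lebesgue_on {0..a}) (\<lambda>s. (f s)\<^sup>2)"

text \<open>Absolute continuity with \<open>h 0 = 0\<close> is expressed as \<open>h\<close> being the indefinite Lebesgue
  integral of its derivative, which is determined up to a null set. Only the values of \<open>h\<close>
  on \<open>{0..T}\<close> matter.\<close>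

definition has_cm_deriv :: "real \<Rightarrow> (real \<Rightarrow> real) \<Rightarrow> (real \<Rightarrow> real) \<Rightarrow> bool" where
  "has_cm_deriv T h f \<longleftrightarrow>
     square_integrable T f \<and> (\<forall>t\<in>{0..T}. h t = integral\<^sup>L (lebesgue_on {0..t}) f)"

definition cm_space :: "real \<Rightarrow> (real \<Rightarrow> real) set" where
  "cm_space T = {h. \<exists>f. has_cm_deriv T h f}"

definition cm_deriv :: "real \<Rightarrow> (real \<Rightarrow> real) \<Rightarrow> real \<Rightarrow> real" where
  "cm_deriv T h = (SOME f. has_cm_deriv T h f)"

definition cm_inner :: "real \<Rightarrow> (real \<Rightarrow> real) \<Rightarrow> (real \<Rightarrow> real) \<Rightarrow> real" where
  "cm_inner T h g = (LINT s|lebesgue_on {0..T}. cm_deriv T h s * cm_deriv T g s)"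

definition chi :: "real \<Rightarrow> real \<Rightarrow> real" where
  "chi t s = min s t"


section \<open>The kernel, its operator and its covariance\<close>

definition kernel_cov :: "(real \<Rightarrow> real \<Rightarrow> real) \<Rightarrow> real \<Rightarrow> real \<Rightarrow> real" where
  "kernel_cov K s t = (LINT r|lebesgue_on {0..min s t}. K t r * K s r)"

definition kernel_op :: "real \<Rightarrow> (real \<Rightarrow> real \<Rightarrow> real) \<Rightarrow> (real \<Rightarrow> real) \<Rightarrow> real \<Rightarrow> real" where
  "kernel_op T K h t = (LINT s|lebesgue_on {0..t}. K t s * cm_deriv T h s)"

text \<open>The functions \<open>h\<close> for which \<open>K h\<close> is differentiable in the sense required by the
  pairing. The operator is allowed to be unbounded, as it is for rough kernels.\<close>

definition kernel_op_dom :: "real \<Rightarrow> (real \<Rightarrow> real \<Rightarrow> real) \<Rightarrow> (real \<Rightarrow> real) set" where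
  "kernel_op_dom T K = {h \<in> cm_space T. kernel_op T K h \<in> cm_space T}"

definition kernel_op_adjoint ::
    "real \<Rightarrow> (real \<Rightarrow> real \<Rightarrow> real) \<Rightarrow> (real \<Rightarrow> real) \<Rightarrow> (real \<Rightarrow> real)" where
  "kernel_op_adjoint T K g =
     (SOME k. k \<in> cm_space T \<and>
        (\<forall>h\<in>kernel_op_dom T K. cm_inner T k h = cm_inner T g (kernel_op T K h)))"

definition Gamma_op ::
    "real \<Rightarrow> (real \<Rightarrow> real \<Rightarrow> real) \<Rightarrow> (real \<Rightarrow> real) \<Rightarrow> (real \<Rightarrow> real)" where
  "Gamma_op T K g = kernel_op T K (kernel_op_adjoint T K g)"

text \<open>The first condition makes \<open>\<gamma>\<close> well-defined. The second makes the adjoint unique (modulo the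
  values of functions outside \<open>{0..T}\<close>), and the third makes \<open>\<langle>\<chi>\<^sub>s, \<Gamma> \<chi>\<^sub>t\<rangle>\<close> meaningful. Given the
  first condition, the other two hold automatically when \<open>K\<close> maps \<open>cm_space T\<close> into itself:
  the domain is then the whole space, and the adjoint at \<open>\<chi>\<^sub>t\<close> is the indefinite integral of
  \<open>K(t, \<cdot>)\<close> restricted to \<open>{0..t}\<close>, hence in the domain.\<close>

definition admissible_kernel :: "real \<Rightarrow> (real \<Rightarrow> real \<Rightarrow> real) \<Rightarrow> bool" where
  "admissible_kernel T K \<longleftrightarrow>
     (\<forall>t\<in>{0..T}. square_integrable t (K t)) \<and>
     (\<forall>h\<in>cm_space T. \<forall>\<epsilon>>0. \<exists>g\<in>kernel_op_dom T K.
        cm_inner T (\<lambda>s. h s - g s) (\<lambda>s. h s - g s) < \<epsilon>) \<and>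
     (\<forall>t\<in>{0..T}. Gamma_op T K (chi t) \<in> cm_space T)"


section \<open>Gaussian processes on path space\<close>

text \<open>Dirac masses count as (degenerate) Gaussian laws.\<close>

definition gaussian_law :: "real measure \<Rightarrow> bool" where
  "gaussian_law N \<longleftrightarrow>
     (\<exists>m \<sigma>. \<sigma> > 0 \<and> N = density lborel (\<lambda>x. ennreal (normal_density m \<sigma> x))) \<or>
     (\<exists>m. N = return borel m)"

definition centered_gaussian_process ::
    "'a measure \<Rightarrow> real set \<Rightarrow> (real \<Rightarrow> real \<Rightarrow> real) \<Rightarrow> (real \<Rightarrow> 'a \<Rightarrow> real) \<Rightarrow> bool" where
  "centered_gaussian_process M I \<gamma> Y \<longleftrightarrow>
     prob_space M \<and>
     (\<forall>t\<in>I. Y t \<in> borel_measurable M) \<and>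
     (\<forall>J c. finite J \<and> J \<subseteq> I \<longrightarrow> gaussian_law (distr M borel (\<lambda>\<omega>. \<Sum>t\<in>J. c t * Y t \<omega>))) \<and>
     (\<forall>t\<in>I. (LINT \<omega>|M. Y t \<omega>) = 0) \<and>
     (\<forall>s\<in>I. \<forall>t\<in>I. (LINT \<omega>|M. Y s \<omega> * Y t \<omega>) = \<gamma> s t)"

text \<open>Continuous paths on \<open>{0..T}\<close> (as functions that are \<open>undefined\<close> outside \<open>{0..T}\<close>) with
  the \<open>\<sigma>\<close>-algebra generated by the coordinate maps.\<close>

definition path_space :: "real \<Rightarrow> (real \<Rightarrow> real) measure" where
  "path_space T = restrict_space (\<Pi>\<^sub>M t\<in>{0..T}. borel) {\<omega>. continuous_on {0..T} \<omega>}"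

text \<open>\<open>M\<close> is the law on path space under which the coordinate process minus \<open>v\<close> is centered
  Gaussian with covariance \<open>\<gamma>\<close>; there is at most one such \<open>M\<close>.\<close>

definition drifted_gaussian_law ::
    "real \<Rightarrow> (real \<Rightarrow> real \<Rightarrow> real) \<Rightarrow> (real \<Rightarrow> real) \<Rightarrow> (real \<Rightarrow> real) measure \<Rightarrow> bool" where
  "drifted_gaussian_law T \<gamma> v M \<longleftrightarrow>
     sets M = sets (path_space T) \<and>
     centered_gaussian_process M {0..T} \<gamma> (\<lambda>t \<omega>. \<omega> t - v t)"


section \<open>Estimators and their risk\<close>

definition estimators :: "real \<Rightarrow> (real \<Rightarrow> (real \<Rightarrow> real) \<Rightarrow> real) set" where
  "estimators T =
     {\<xi>. (\<lambda>(t, \<omega>). \<xi> t \<omega>) \<in> borel_measurable (restrict_space borel {0..T} \<Otimes>\<^sub>M path_space T)}"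

definition coordinate_estimator :: "real \<Rightarrow> (real \<Rightarrow> real) \<Rightarrow> real" where
  "coordinate_estimator t \<omega> = \<omega> t"

definition quadratic_risk ::
    "(real \<Rightarrow> real) measure \<Rightarrow> real measure \<Rightarrow>
     (real \<Rightarrow> (real \<Rightarrow> real) \<Rightarrow> real) \<Rightarrow> (real \<Rightarrow> real) \<Rightarrow> ennreal" where
  "quadratic_risk M \<mu> \<xi> v = (\<integral>\<^sup>+\<omega>. (\<integral>\<^sup>+t. ennreal (\<bar>\<xi> t \<omega> - v t\<bar>\<^sup>2) \<partial>\<mu>) \<partial>M)"

definition gaussian_risk :: "real \<Rightarrow> (real \<Rightarrow> real \<Rightarrow> real) \<Rightarrow> real measure \<Rightarrow> real" where
  "gaussian_risk T K \<mu> = (LINT t|\<mu>. cm_inner T (chi t) (Gamma_op T K (chi t)))"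

end

theory Submission
  imports Defs "HOL-Real_Asymp.Real_Asymp"
begin

text \<open>
  The coordinate process has risk \<open>\<integral> \<gamma>(t,t) \<mu>(dt)\<close> under every drift, because
  \<open>X\<^sub>t - v\<^sub>t\<close> is centered with variance \<open>\<gamma>(t,t)\<close>. This constant equals the expression in terms of
  \<open>\<Gamma>\<close>: the function \<open>\<chi>\<^sub>t\<close> represents evaluation at \<open>t\<close> for the pairing of derivatives, and
  the adjoint of \<open>K\<close> at \<open>\<chi>\<^sub>t\<close> has derivative \<open>K(t, \<cdot>)\<close> on \<open>{0..t}\<close>
  (\<open>cm_inner_chi_Gamma_op\<close>).

  That no estimator does better in the worst case is a Bayes argument. The supremum over all drifts
  dominates the average over random drifts \<open>a Z\<close>, where \<open>Z\<close> is an independent copy of the centered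
  Gaussian noise \<open>Y\<close> and \<open>a\<close> is a constant; its paths are continuous, so the prior lives on the
  parameter set. The observation is \<open>X = Y + a Z\<close>, and the posterior variance of the drift at \<open>t\<close> is
  \<open>a\<^sup>2 / (1 + a\<^sup>2) \<cdot> \<gamma>(t,t)\<close>, which tends to \<open>\<gamma>(t,t)\<close> as \<open>a\<close> grows.

  Conditional expectations are avoided by a symmetry. The orthogonal reflection of the plane that
  fixes the direction \<open>(1, a)\<close>, applied to \<open>(Y\<^sub>t, Z\<^sub>t)\<close> for every \<open>t\<close> at once, preserves the joint
  law and the observation \<open>X\<close>, but replaces the drift \<open>a Z\<close> by some \<open>a Z'\<close>. An estimate based on
  \<open>X\<close> cannot distinguish the two, so averaging its loss over both gives at least a quarter of
  \<open>(a Z\<^sub>t - a Z'\<^sub>t)\<^sup>2\<close>, whose expectation is computed directly (\<open>bayes_risk_bound\<close>).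

  Both the invariance under the reflection and the fact that the law with drift \<open>v\<close> is the translate
  by \<open>v\<close> of the driftless law are instances of one uniqueness principle: a finite measure is
  determined by the characteristic functions of a linear space of functionals that generates its
  \<open>\<sigma>\<close>-algebra (\<open>measure_eqI_linear_functionals\<close>).
\<close>

section \<open>Finite measures determined by characteristic functions\<close>

text \<open>Both measures have the same total mass, the value of the characteristic function at \<open>0\<close>. Unless
  it vanishes, dividing by it reduces the claim to Levy's theorem for probability measures.\<close>

lemma finite_measure_Levy_uniqueness:
  fixes M N :: "real measure"
  assumes "finite_measure M" "finite_measure N" and sets: "sets M = sets borel" "sets N = sets borel"
    and char: "\<And>t. char M t = char N t"
  shows "M = N"
proof -
  interpret M: finite_measure M by fact
  interpret N: finite_measure N by fact
  define m where "m = measure M UNIV"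
  have sp: "space M = UNIV" "space N = UNIV"
    using sets_eq_imp_space_eq[OF sets(1)] sets_eq_imp_space_eq[OF sets(2)] by auto
  have mN: "measure N UNIV = m"
    using char[of 0] by (simp add: char_def m_def sp)
  show ?thesis
  proof (cases "m = 0")
    case True
    show ?thesis
    proof (rule measure_eqI)
      fix A assume A: "A \<in> sets M"
      have "measure M A \<le> m" "measure N A \<le> m"
        using M.finite_measure_mono[of A UNIV] N.finite_measure_mono[of A UNIV] A mN sets
        by (auto simp: m_def)
      with True have "measure M A = 0" "measure N A = 0"
        by (auto simp: measure_le_0_iff)
      then show "emeasure M A = emeasure N A"
        by (simp add: M.emeasure_eq_measure N.emeasure_eq_measure)
    qed (simp add: sets)
  next
    case False
    then have m: "m > 0" by (simp add: m_def zero_less_measure_iff)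
    define S :: "real measure \<Rightarrow> real measure" where "S = (\<lambda>R. density R (\<lambda>_. ennreal (1 / m)))"
    have em: "emeasure (S R) A = emeasure R A / ennreal m"
      if "A \<in> sets R" for R A
      using that m by (simp add: S_def emeasure_density_const divide_ennreal_def inverse_ennreal mult.commute inverse_eq_divide)
    have S: "real_distribution (S R)"
      if R: "finite_measure R" "sets R = sets borel" "measure R UNIV = m" for R
    proof -
      interpret R: finite_measure R by fact
      have "space R = UNIV" using sets_eq_imp_space_eq[OF R(2)] by simp
      then have "emeasure (S R) UNIV = 1"
        using R m by (subst em) (auto simp: R.emeasure_eq_measure divide_ennreal)
      then show ?thesis
        using \<open>space R = UNIV\<close>
        by (auto intro!: real_distribution.intro prob_spaceI simp: real_distribution_axioms_def S_def R)
    qed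
    have "char (S R) t = char R t / m" if "sets R = sets borel" for R t
    proof -
      have "(\<lambda>x. iexp (t * x)) \<in> borel_measurable R"
        unfolding measurable_cong_sets[OF that refl] by measurable
      then show ?thesis
        using m unfolding S_def char_def
        by (subst integral_density) (auto simp: scaleR_conv_of_real)
    qed
    then have "S M = S N"
      using S[of M] S[of N] sets mN by (intro Levy_uniqueness ext) (auto simp: m_def char assms)
    then have "emeasure M A / ennreal m = emeasure N A / ennreal m" if "A \<in> sets borel" for A
      using em[of A M] em[of A N] that sets by simp
    moreover have "x = y" if "x / ennreal m = y / ennreal m" for x y :: ennreal
      using that m by (metis ennreal_divide_times ennreal_neq_top ennreal_top_neq_zero
          ennreal_mult_divide_eq ennreal_eq_0_iff not_le mult_divide_eq_ennreal mult.commute)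
    ultimately show ?thesis
      using sets by (intro measure_eqI) auto
  qed
qed

text \<open>Call a set \<open>B\<close> good if the integrals of \<open>1\<^sub>B cos (l + \<theta>)\<close> agree for all \<open>l\<close> in \<open>L\<close> and all phases
  \<open>\<theta>\<close>. The whole space is good by hypothesis. Good sets are closed under intersection with
  \<open>{l\<^sub>0 \<in> A}\<close>: weighting by the nonnegative function \<open>1\<^sub>B (1 + cos (l + \<theta>))\<close> and pushing forward
  along \<open>l\<^sub>0\<close> gives finite measures on the line, whose characteristic functions agree because a
  product of two cosines is a sum of cosines of functionals in \<open>L\<close>. The one-dimensional uniqueness
  theorem then applies. Hence all finite intersections of sets \<open>{l \<in> A}\<close> are good, and
  they form a \<open>\<pi>\<close>-system that generates the \<open>\<sigma>\<close>-algebra. The hypothesis on generation is phrased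
  as minimality among \<open>\<sigma>\<close>-algebras that make every functional measurable.\<close>

lemma measure_eqI_linear_functionals:
  fixes L :: "('a \<Rightarrow> real) set"
  assumes fin: "finite_measure M" "finite_measure N" and sets: "sets M = sets N"
    and meas: "\<And>l. l \<in> L \<Longrightarrow> l \<in> borel_measurable M"
    and ne: "L \<noteq> {}"
    and add: "\<And>l l'. l \<in> L \<Longrightarrow> l' \<in> L \<Longrightarrow> (\<lambda>\<omega>. l \<omega> + l' \<omega>) \<in> L"
    and scale: "\<And>c l. l \<in> L \<Longrightarrow> (\<lambda>\<omega>. c * l \<omega>) \<in> L"
    and gen: "\<And>M'. space M' = space M \<Longrightarrow> (\<And>l. l \<in> L \<Longrightarrow> l \<in> borel_measurable M') \<Longrightarrow> sets M \<subseteq> sets M'"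
    and char: "\<And>l. l \<in> L \<Longrightarrow> (CLINT \<omega>|M. iexp (l \<omega>)) = (CLINT \<omega>|N. iexp (l \<omega>))"
  shows "M = N"
proof -
  interpret M: finite_measure M by fact
  interpret N: finite_measure N by fact
  have sp: "space M = space N" by (rule sets_eq_imp_space_eq[OF sets])
  have measN: "l \<in> borel_measurable N" if "l \<in> L" for l
    using meas[OF that] measurable_cong_sets[OF sets refl] by blast
  note [measurable] = meas measN
  define good where "good B \<longleftrightarrow> B \<in> sets M \<and> (\<forall>l\<in>L. \<forall>\<theta>.
    (LINT \<omega>|M. indicator B \<omega> * cos (l \<omega> + \<theta>)) = (LINT \<omega>|N. indicator B \<omega> * cos (l \<omega> + \<theta>)))" for B
  have bdd: "integrable R f" if "finite_measure R" "f \<in> borel_measurable R" "\<And>x. \<bar>f x\<bar> \<le> 4"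
    for R and f :: "'a \<Rightarrow> real"
    using that by (intro finite_measure.integrable_const_bound[where B=4]) auto
  have goodD: "(LINT \<omega>|M. indicator B \<omega> * cos (l \<omega> + \<theta>)) = (LINT \<omega>|N. indicator B \<omega> * cos (l \<omega> + \<theta>))"
    if "good B" "l \<in> L" for B l \<theta>
    using that by (auto simp: good_def)
  have good_sets: "B \<in> sets M" "B \<in> sets N" if "good B" for B
    using that sets by (auto simp: good_def)
  have ind_space: "(LINT \<omega>|R. indicator (space R) \<omega> * f \<omega>) = (LINT \<omega>|R. f \<omega>)" for R and f :: "'a \<Rightarrow> real"
    by (rule Bochner_Integration.integral_cong) auto
  have good_space: "good (space M)"
    unfolding good_def
  proof (intro conjI ballI allI)
    fix l \<theta> assume l: "l \<in> L"
    have *: "(LINT \<omega>|R. cos (l \<omega> + \<theta>)) = Re (CLINT \<omega>|R. iexp (l \<omega>)) * cos \<theta> - Im (CLINT \<omega>|R. iexp (l \<omega>)) * sin \<theta>"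
      if R: "finite_measure R" and lR[measurable]: "l \<in> borel_measurable R" for R
    proof -
      interpret R: finite_measure R by fact
      have ci: "integrable R (\<lambda>\<omega>. iexp (l \<omega>))"
        by (intro R.integrable_const_bound[where B=1]) auto
      have r: "integrable R (\<lambda>\<omega>. cos (l \<omega>))" "integrable R (\<lambda>\<omega>. sin (l \<omega>))"
        by (intro R.integrable_const_bound[where B=1]; auto)+
      have e: "Re (CLINT \<omega>|R. iexp (l \<omega>)) = (LINT \<omega>|R. cos (l \<omega>))"
        "Im (CLINT \<omega>|R. iexp (l \<omega>)) = (LINT \<omega>|R. sin (l \<omega>))"
        by (simp_all flip: integral_Re[OF ci] integral_Im[OF ci] add: Re_exp Im_exp)
      show ?thesis
        unfolding cos_add e using r by simp
    qed
    have "(LINT \<omega>|M. cos (l \<omega> + \<theta>)) = (LINT \<omega>|N. cos (l \<omega> + \<theta>))"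
      unfolding *[OF fin(1) meas[OF l]] *[OF fin(2) measN[OF l]] char[OF l] ..
    then show "(LINT \<omega>|M. indicator (space M) \<omega> * cos (l \<omega> + \<theta>)) = (LINT \<omega>|N. indicator (space M) \<omega> * cos (l \<omega> + \<theta>))"
      using ind_space[of M] ind_space[of N] sp by simp
  qed auto
  have step: "good (B \<inter> (l0 -` A \<inter> space M))"
    if B: "good B" and l0: "l0 \<in> L" and A[measurable]: "A \<in> sets borel" for B l0 A
  proof -
    note [measurable] = good_sets[OF B] meas[OF l0] measN[OF l0]
    have key: "(LINT \<omega>|M. (indicator B \<omega> * (1 + cos (l \<omega> + \<theta>))) * indicator A (l0 \<omega>))
             = (LINT \<omega>|N. (indicator B \<omega> * (1 + cos (l \<omega> + \<theta>))) * indicator A (l0 \<omega>))"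
      if l: "l \<in> L" for l \<theta>
    proof -
      note [measurable] = meas[OF l] measN[OF l]
      define g where "g = (\<lambda>\<omega>. indicator B \<omega> * (1 + cos (l \<omega> + \<theta>)) :: real)"
      have g[measurable]: "g \<in> borel_measurable M" "g \<in> borel_measurable N"
        unfolding g_def by measurable
      have g0: "g \<omega> \<ge> 0" and g2: "g \<omega> \<le> 2" for \<omega>
        using cos_ge_minus_one[of "l \<omega> + \<theta>"] cos_le_one[of "l \<omega> + \<theta>"]
        by (auto simp: g_def indicator_def simp del: cos_ge_minus_one cos_le_one)
      define D where "D R = distr (density R (\<lambda>\<omega>. ennreal (g \<omega>))) borel l0" for R
      have finD: "finite_measure (D R)"
        if R: "finite_measure R" "g \<in> borel_measurable R" "l0 \<in> borel_measurable R" for R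
      proof -
        interpret R: finite_measure R by fact
        have "(\<integral>\<^sup>+\<omega>. ennreal (g \<omega>) \<partial>R) \<le> (\<integral>\<^sup>+\<omega>. 2 \<partial>R)"
          using g2 by (intro nn_integral_mono) (metis ennreal_le_iff ennreal_numeral zero_le_numeral)
        also have "\<dots> < \<infinity>" using R.emeasure_finite[of "space R"] by (simp add: ennreal_mult_eq_top_iff less_top[symmetric])
        finally have "finite_measure (density R (\<lambda>\<omega>. ennreal (g \<omega>)))"
          using R by (intro finite_measureI) (auto simp: emeasure_density cong: nn_integral_cong)
        then show ?thesis
          unfolding D_def using R by (intro finite_measure.finite_measure_distr) auto
      qed
      have intD: "integral\<^sup>L (D R) f = (LINT \<omega>|R. g \<omega> *\<^sub>R f (l0 \<omega>))"
        if "g \<in> borel_measurable R" "l0 \<in> borel_measurable R" "f \<in> borel_measurable borel"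
        for R and f :: "real \<Rightarrow> 'b::{banach, second_countable_topology}"
        using that g0 by (simp add: D_def integral_distr integral_density)
      \<comment> \<open>A phase \<open>\<phi>\<close> covers real and imaginary parts of the characteristic function at once.\<close>
      have cosg: "(LINT \<omega>|M. g \<omega> * cos (s * l0 \<omega> + \<phi>)) = (LINT \<omega>|N. g \<omega> * cos (s * l0 \<omega> + \<phi>))" for s \<phi>
      proof -
        have sl: "(\<lambda>\<omega>. s * l0 \<omega>) \<in> L" "(\<lambda>\<omega>. l \<omega> + s * l0 \<omega>) \<in> L" "(\<lambda>\<omega>. l \<omega> + -s * l0 \<omega>) \<in> L"
          using add[OF l scale[OF l0, of s]] add[OF l scale[OF l0, of "-s"]] scale[OF l0, of s] by auto
        have e: "g \<omega> * cos (s * l0 \<omega> + \<phi>) = indicator B \<omega> * cos (s * l0 \<omega> + \<phi>)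
           + (1/2) * (indicator B \<omega> * cos ((l \<omega> + s * l0 \<omega>) + (\<theta> + \<phi>)))
           + (1/2) * (indicator B \<omega> * cos ((l \<omega> + -s * l0 \<omega>) + (\<theta> - \<phi>)))" for \<omega>
        proof -
          have "cos (l \<omega> + \<theta>) * cos (s * l0 \<omega> + \<phi>)
            = (cos ((l \<omega> + -s * l0 \<omega>) + (\<theta> - \<phi>)) + cos ((l \<omega> + s * l0 \<omega>) + (\<theta> + \<phi>))) / 2"
            unfolding cos_times_cos by (simp add: algebra_simps)
          moreover have "g \<omega> * cos (s * l0 \<omega> + \<phi>) = indicator B \<omega> * cos (s * l0 \<omega> + \<phi>)
              + indicator B \<omega> * (cos (l \<omega> + \<theta>) * cos (s * l0 \<omega> + \<phi>))"
            by (simp add: g_def distrib_left distrib_right mult.assoc)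
          ultimately show ?thesis by (simp add: distrib_left add_divide_distrib)
        qed
        have ab: "\<bar>indicator B x * cos y\<bar> \<le> 4" for x and y :: real
          using abs_cos_le_one[of y] by (auto simp: indicator_def simp del: abs_cos_le_one)
        have "(LINT \<omega>|R. g \<omega> * cos (s * l0 \<omega> + \<phi>)) = (LINT \<omega>|R. indicator B \<omega> * cos (s * l0 \<omega> + \<phi>))
           + (1/2) * (LINT \<omega>|R. indicator B \<omega> * cos ((l \<omega> + s * l0 \<omega>) + (\<theta> + \<phi>)))
           + (1/2) * (LINT \<omega>|R. indicator B \<omega> * cos ((l \<omega> + -s * l0 \<omega>) + (\<theta> - \<phi>)))"
          if R: "finite_measure R" and [measurable]: "B \<in> sets R" "l0 \<in> borel_measurable R" "l \<in> borel_measurable R" for R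
        proof -
          have i: "integrable R (\<lambda>\<omega>. indicator B \<omega> * cos (s * l0 \<omega> + \<phi>))"
            "integrable R (\<lambda>\<omega>. indicator B \<omega> * cos ((l \<omega> + s * l0 \<omega>) + (\<theta> + \<phi>)))"
            "integrable R (\<lambda>\<omega>. indicator B \<omega> * cos ((l \<omega> + -s * l0 \<omega>) + (\<theta> - \<phi>)))"
            by (rule bdd[OF R _ ab], measurable)+
          show ?thesis unfolding e using i by simp
        qed
        note this[OF fin(1)] this[OF fin(2)]
        then show ?thesis
          using goodD[OF B sl(1)] goodD[OF B sl(2)] goodD[OF B sl(3)] by simp
      qed
      have "D M = D N"
      proof (rule finite_measure_Levy_uniqueness)
        fix s
        have "char (D R) s = complex_of_real (LINT \<omega>|R. g \<omega> * cos (s * l0 \<omega> + 0))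
                + \<i> * complex_of_real (LINT \<omega>|R. g \<omega> * cos (s * l0 \<omega> + (- pi / 2)))"
          if R: "finite_measure R" and [measurable]: "g \<in> borel_measurable R" "l0 \<in> borel_measurable R" for R
        proof -
          have ab: "\<bar>g x * cos y\<bar> \<le> 4" for x y
            using abs_cos_le_one[of y] g0[of x] g2[of x] mult_mono[of "\<bar>g x\<bar>" 2 "\<bar>cos y\<bar>" 1]
            by (auto simp: abs_mult simp del: abs_cos_le_one)
          have i: "integrable R (\<lambda>\<omega>. g \<omega> * cos (s * l0 \<omega> + 0))" "integrable R (\<lambda>\<omega>. g \<omega> * cos (s * l0 \<omega> + (- pi / 2)))"
            by (rule bdd[OF R _ ab], measurable)+
          have "char (D R) s = (CLINT \<omega>|R. complex_of_real (g \<omega> * cos (s * l0 \<omega> + 0))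
             + \<i> * complex_of_real (g \<omega> * cos (s * l0 \<omega> + (- pi / 2))))"
          proof -
            have "g \<omega> *\<^sub>R iexp (s * l0 \<omega>) = complex_of_real (g \<omega> * cos (s * l0 \<omega> + 0))
                + \<i> * complex_of_real (g \<omega> * cos (s * l0 \<omega> + (- pi / 2)))" for \<omega>
              by (simp add: complex_eq_iff Re_exp Im_exp cos_diff)
            then show ?thesis
              unfolding char_def by (subst intD) simp_all
          qed
          then show ?thesis
            using integrable_of_real[OF i(1), where 'a = complex] integrable_of_real[OF i(2), where 'a = complex]
            by (simp only: Bochner_Integration.integral_add integrable_mult_right
                integral_mult_right_zero integral_complex_of_real)
        qed
        then show "char (D M) s = char (D N) s"
          using fin cosg[of s 0] cosg[of s "- pi / 2"] by simp
        show "finite_measure (D M)" "finite_measure (D N)"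
          using finD[OF fin(1)] finD[OF fin(2)] by simp_all
      qed (simp_all add: D_def)
      then have "integral\<^sup>L (D M) (indicator A :: real \<Rightarrow> real) = integral\<^sup>L (D N) (indicator A)" by simp
      then show ?thesis
        by (subst (asm) (1 2) intD) (auto simp: g_def)
    qed
    show ?thesis
      unfolding good_def
    proof (intro conjI ballI allI)
      show "B \<inter> (l0 -` A \<inter> space M) \<in> sets M" by measurable
      fix l \<theta> assume l: "l \<in> L"
      note [measurable] = meas[OF l] measN[OF l]
      obtain l1 where l1: "l1 \<in> L" using ne by blast
      \<comment> \<open>The weight with \<open>l = 0\<close> and \<open>\<theta> = 0\<close> is \<open>2 1\<^sub>B\<close>; subtracting half of it leaves the cosine.\<close>
      have l00: "(\<lambda>\<omega>. 0 * l1 \<omega>) \<in> L" by (rule scale[OF l1])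
      have e: "(LINT \<omega>|R. indicator (B \<inter> (l0 -` A \<inter> space R)) \<omega> * cos (l \<omega> + \<theta>))
        = (LINT \<omega>|R. (indicator B \<omega> * (1 + cos (l \<omega> + \<theta>))) * indicator A (l0 \<omega>))
          - (1/2) * (LINT \<omega>|R. (indicator B \<omega> * (1 + cos (0 * l1 \<omega> + 0))) * indicator A (l0 \<omega>))"
        if R: "finite_measure R" and [measurable]: "B \<in> sets R" "l0 \<in> borel_measurable R" "l \<in> borel_measurable R" for R
      proof -
        have ab: "\<bar>(indicator B x * (1 + cos y)) * indicator A z\<bar> \<le> 4" for x and y z :: real
          using abs_cos_le_one[of y] by (auto simp: indicator_def simp del: abs_cos_le_one)
        have i: "integrable R (\<lambda>\<omega>. (indicator B \<omega> * (1 + cos (l \<omega> + \<theta>))) * indicator A (l0 \<omega>))"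
          "integrable R (\<lambda>\<omega>. (indicator B \<omega> * (1 + cos (0 * l1 \<omega> + 0))) * indicator A (l0 \<omega>))"
          by (rule bdd[OF R _ ab], simp, measurable)+
        have "(LINT \<omega>|R. indicator (B \<inter> (l0 -` A \<inter> space R)) \<omega> * cos (l \<omega> + \<theta>))
          = (LINT \<omega>|R. (indicator B \<omega> * (1 + cos (l \<omega> + \<theta>))) * indicator A (l0 \<omega>)
             - (1/2) * ((indicator B \<omega> * (1 + cos (0 * l1 \<omega> + 0))) * indicator A (l0 \<omega>)))"
          by (rule Bochner_Integration.integral_cong) (auto simp: indicator_def)
        then show ?thesis
          using i by (simp only: Bochner_Integration.integral_diff integrable_mult_right integral_mult_right_zero)
      qed
      show "(LINT \<omega>|M. indicator (B \<inter> (l0 -` A \<inter> space M)) \<omega> * cos (l \<omega> + \<theta>))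
        = (LINT \<omega>|N. indicator (B \<inter> (l0 -` A \<inter> space M)) \<omega> * cos (l \<omega> + \<theta>))"
        using e[OF fin(1)] e[OF fin(2)] key[OF l, of \<theta>] key[OF l00, of 0] by (simp add: sp)
    qed
  qed
  define G where "G = {l -` A \<inter> space M | l A. l \<in> L \<and> A \<in> sets borel}"
  define E where "E = {space M \<inter> \<Inter>F | F. finite F \<and> F \<subseteq> G}"
  have goodE: "good (space M \<inter> \<Inter>F)" if "finite F" "F \<subseteq> G" for F
    using that
  proof (induction F)
    case (insert C F)
    then obtain l A where "l \<in> L" "A \<in> sets borel" "C = l -` A \<inter> space M" by (auto simp: G_def)
    with step[of "space M \<inter> \<Inter>F" l A] insert show ?case by (simp add: Int_ac)
  qed (simp add: good_space)
  have good_eq: "emeasure M B = emeasure N B" if B: "good B" for B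
  proof -
    obtain l1 where l1: "l1 \<in> L" using ne by blast
    have "(\<lambda>\<omega>. 0 * l1 \<omega>) \<in> L" by (rule scale[OF l1])
    from goodD[OF B this, of 0] good_sets[OF B] show ?thesis
      by (simp add: M.emeasure_eq_measure N.emeasure_eq_measure)
  qed
  have GE: "G \<subseteq> E"
  proof
    fix C assume "C \<in> G"
    then have "C = space M \<inter> \<Inter>{C}" "finite {C}" "{C} \<subseteq> G" by (auto simp: G_def)
    then show "C \<in> E" unfolding E_def by blast
  qed
  have EM: "E \<subseteq> sets M" using goodE good_sets by (auto simp: E_def)
  have sig: "sets M = sigma_sets (space M) E"
  proof
    have "E \<subseteq> Pow (space M)" by (auto simp: E_def)
    moreover from this have "l \<in> borel_measurable (sigma (space M) E)" if "l \<in> L" for l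
    proof (intro measurableI)
      fix A :: "real set" assume "A \<in> sets borel"
      with that have "l -` A \<inter> space M \<in> E" using GE by (auto simp: G_def)
      with \<open>E \<subseteq> Pow (space M)\<close> show "l -` A \<inter> space (sigma (space M) E) \<in> sets (sigma (space M) E)"
        by simp
    qed simp
    ultimately show "sets M \<subseteq> sigma_sets (space M) E"
      using gen[of "sigma (space M) E"] by simp
    show "sigma_sets (space M) E \<subseteq> sets M"
      by (rule sets.sigma_sets_subset[OF EM])
  qed
  show ?thesis
  proof (rule measure_eqI_generator_eq[where E = E and \<Omega> = "space M" and A = "\<lambda>_. space M"])
    show "Int_stable E"
    proof (rule Int_stableI)
      fix a b assume "a \<in> E" "b \<in> E"
      then obtain F F' where "a = space M \<inter> \<Inter>F" "b = space M \<inter> \<Inter>F'" "finite (F \<union> F')" "F \<union> F' \<subseteq> G"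
        by (auto simp: E_def)
      moreover from this have "a \<inter> b = space M \<inter> \<Inter>(F \<union> F')" by auto
      ultimately show "a \<inter> b \<in> E" unfolding E_def by blast
    qed
    show "E \<subseteq> Pow (space M)" by (auto simp: E_def)
    show "emeasure M X = emeasure N X" if "X \<in> E" for X
      using that goodE good_eq by (auto simp: E_def)
    show "sets M = sigma_sets (space M) E" by (rule sig)
    then show "sets N = sigma_sets (space M) E" using sets by simp
    show "range (\<lambda>_. space M) \<subseteq> E" using GE unfolding E_def by (auto intro!: exI[of _ "{}"])
  qed auto
qed

text \<open>The Cramer-Wold device for families of vectors. Vector values allow a pair of processes to be
  treated as one process with values in the plane, on which a rotation or reflection acts linearly.\<close>

lemma measure_eqI_vector_family:
  fixes X :: "'i \<Rightarrow> 'a \<Rightarrow> 'e::euclidean_space"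
  assumes fin: "finite_measure M" "finite_measure N" and sets: "sets M = sets N"
    and meas: "\<And>i. i \<in> I \<Longrightarrow> X i \<in> borel_measurable M"
    and gen: "\<And>M'. space M' = space M \<Longrightarrow> (\<And>i. i \<in> I \<Longrightarrow> X i \<in> borel_measurable M') \<Longrightarrow> sets M \<subseteq> sets M'"
    and char: "\<And>J c. finite J \<Longrightarrow> J \<subseteq> I \<Longrightarrow>
      (CLINT \<omega>|M. iexp (\<Sum>i\<in>J. c i \<bullet> X i \<omega>)) = (CLINT \<omega>|N. iexp (\<Sum>i\<in>J. c i \<bullet> X i \<omega>))"
  shows "M = N"
proof -
  define L where "L = {\<lambda>\<omega>. \<Sum>i\<in>J. c i \<bullet> X i \<omega> | J c. finite J \<and> J \<subseteq> I}"
  have LI: "(\<lambda>\<omega>. \<Sum>i\<in>J. c i \<bullet> X i \<omega>) \<in> L" if "finite J" "J \<subseteq> I" for J c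
    using that by (auto simp: L_def)
  show ?thesis
  proof (rule measure_eqI_linear_functionals[where L = L, OF fin sets])
    show "L \<noteq> {}" using LI[of "{}"] by auto
    fix l assume "l \<in> L"
    then obtain J c where J: "finite J" "J \<subseteq> I" and l: "l = (\<lambda>\<omega>. \<Sum>i\<in>J. c i \<bullet> X i \<omega>)"
      by (auto simp: L_def)
    show "l \<in> borel_measurable M"
      unfolding l using J meas by (intro borel_measurable_sum borel_measurable_inner) auto
    show "(CLINT \<omega>|M. iexp (l \<omega>)) = (CLINT \<omega>|N. iexp (l \<omega>))"
      unfolding l by (rule char[OF J])
    show "(\<lambda>\<omega>. r * l \<omega>) \<in> L" for r
      using LI[OF J, of "\<lambda>i. r *\<^sub>R c i"] by (simp add: l sum_distrib_left)
    fix l' assume "l' \<in> L"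
    then obtain J' c' where J': "finite J'" "J' \<subseteq> I" and l': "l' = (\<lambda>\<omega>. \<Sum>i\<in>J'. c' i \<bullet> X i \<omega>)"
      by (auto simp: L_def)
    let ?d = "\<lambda>i. (if i \<in> J then c i else 0) + (if i \<in> J' then c' i else 0)"
    have "l \<omega> + l' \<omega> = (\<Sum>i\<in>J \<union> J'. ?d i \<bullet> X i \<omega>)" for \<omega>
    proof -
      have "l \<omega> = (\<Sum>i\<in>J \<union> J'. (if i \<in> J then c i else 0) \<bullet> X i \<omega>)"
        unfolding l using J J' by (intro sum.mono_neutral_cong_left) auto
      moreover have "l' \<omega> = (\<Sum>i\<in>J \<union> J'. (if i \<in> J' then c' i else 0) \<bullet> X i \<omega>)"
        unfolding l' using J J' by (intro sum.mono_neutral_cong_left) auto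
      ultimately show ?thesis by (simp only: sum.distrib inner_add_left)
    qed
    with LI[of "J \<union> J'" ?d] J J' show "(\<lambda>\<omega>. l \<omega> + l' \<omega>) \<in> L" by simp
  next
    fix M' assume "space M' = space M" and L: "\<And>l. l \<in> L \<Longrightarrow> l \<in> borel_measurable M'"
    moreover have "X i \<in> borel_measurable M'" if i: "i \<in> I" for i
      unfolding borel_measurable_euclidean_space[of "X i"]
    proof
      fix b :: 'e
      show "(\<lambda>\<omega>. X i \<omega> \<bullet> b) \<in> borel_measurable M'"
        using L[OF LI[of "{i}" "\<lambda>_. b"]] i by (simp add: inner_commute)
    qed
    ultimately show "sets M \<subseteq> sets M'" using gen by blast
  qed
qed

section \<open>Square-integrable derivatives and the operator \<open>\<Gamma>\<close>\<close>

lemma lebesgue_on_subinterval: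
  fixes F :: "real \<Rightarrow> real"
  assumes "t \<le> a"
  shows "integral\<^sup>L (lebesgue_on {0..t}) F = (LINT s|lebesgue_on {0..a}. indicator {0..t} s * F s)"
    and "integrable (lebesgue_on {0..t}) F \<longleftrightarrow> integrable (lebesgue_on {0..a}) (\<lambda>s. indicator {0..t} s * F s)"
    and "F \<in> borel_measurable (lebesgue_on {0..t}) \<longleftrightarrow>
      (\<lambda>s. indicator {0..t} s * F s) \<in> borel_measurable (lebesgue_on {0..a})"
proof -
  have e: "(\<lambda>s. indicator {0..a} s * (indicator {0..t} s * F s)) = (\<lambda>s. indicator {0..t} s * F s)"
    using assms by (auto simp: indicator_def fun_eq_iff)
  show "integral\<^sup>L (lebesgue_on {0..t}) F = (LINT s|lebesgue_on {0..a}. indicator {0..t} s * F s)"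
    by (simp add: integral_restrict_space e)
  show "integrable (lebesgue_on {0..t}) F \<longleftrightarrow> integrable (lebesgue_on {0..a}) (\<lambda>s. indicator {0..t} s * F s)"
    by (simp add: integrable_restrict_space e)
  show "F \<in> borel_measurable (lebesgue_on {0..t}) \<longleftrightarrow>
      (\<lambda>s. indicator {0..t} s * F s) \<in> borel_measurable (lebesgue_on {0..a})"
    by (simp add: borel_measurable_restrict_space_iff e)
qed

lemma finite_measure_lebesgue_on_interval: "finite_measure (lebesgue_on {a..b::real})"
  by (rule finite_measureI) (cases "a \<le> b"; simp add: emeasure_restrict_space)

text \<open>The positive and negative parts of a Borel version of \<open>F\<close> are densities of two finite measures
  that agree on every half line \<open>{x<..}\<close>, hence coincide; densities are unique almost everywhere.\<close>

lemma AE_zero_if_primitive_zero: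
  fixes F :: "real \<Rightarrow> real"
  assumes F: "integrable (lebesgue_on {0..a}) F" and a: "0 \<le> a"
    and zero: "\<And>t. t \<in> {0..a} \<Longrightarrow> integral\<^sup>L (lebesgue_on {0..t}) F = 0"
  shows "AE s in lebesgue_on {0..a}. F s = 0"
proof -
  define G where "G = (\<lambda>s. indicator {0..a} s * F s)"
  have G: "integrable lebesgue G"
    using F integrable_restrict_space[of "{0..a}" lebesgue F] by (simp add: G_def)
  obtain G' where G'[measurable]: "G' \<in> borel_measurable lborel" and eq: "AE s in lborel. G s = G' s"
    using completion_ex_borel_measurable_real[of G lborel] borel_measurable_integrable[OF G] by auto
  have eqL: "AE s in lebesgue. G s = G' s" by (rule AE_completion[OF eq])
  have iL: "integrable lebesgue G'"
  proof (rule iffD1[OF integrable_cong_AE[OF borel_measurable_integrable[OF G] _ eqL] G])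
    show "G' \<in> borel_measurable lebesgue" using G' by (rule measurable_completion)
  qed
  then have i: "integrable lborel G'" by (simp add: integrable_completion)
  have G_upto: "(LINT s|lebesgue. indicator {0..t} s * G s) = 0" if "t \<in> {0..a}" for t
  proof -
    have "(LINT s|lebesgue. indicator {0..t} s * G s) = (LINT s|lebesgue. indicator {0..t} s *\<^sub>R F s)"
      using that by (intro Bochner_Integration.integral_cong) (auto simp: G_def indicator_def)
    with zero[OF that] show ?thesis by (simp add: integral_restrict_space)
  qed
  have tail: "(LINT s|lborel. indicator {x<..} s * G' s) = 0" for x
  proof -
    have iG: "integrable lebesgue (\<lambda>s. indicator S s * G s)" if "S \<in> sets lebesgue" for S
      using integrable_mult_indicator[OF that G] by simp
    have "(LINT s|lborel. indicator {x<..} s * G' s) = (LINT s|lebesgue. indicator {x<..} s * G' s)"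
      by (rule integral_completion[symmetric]) measurable
    also have "\<dots> = (LINT s|lebesgue. indicator {x<..} s * G s)"
    proof (rule integral_cong_AE)
      show "AE s in lebesgue. indicator {x<..} s * G' s = indicator {x<..} s * G s"
        using eqL by eventually_elim simp
    qed (use iG[of "{x<..}", THEN borel_measurable_integrable]
        integrable_mult_indicator[OF _ iL, of "{x<..}", THEN borel_measurable_integrable] in auto)
    also have "\<dots> = (LINT s|lebesgue. indicator {0..a} s * G s - indicator {0..min a x} s * G s)"
      if "x \<ge> 0"
      using that by (intro Bochner_Integration.integral_cong) (auto simp: G_def indicator_def)
    also have "\<dots> = 0" if "x \<ge> 0"
      using that a G_upto[of a] G_upto[of "min a x"] iG[of "{0..a}"] iG[of "{0..min a x}"] by simp
    finally have "(LINT s|lborel. indicator {x<..} s * G' s) = 0" if "x \<ge> 0" using that by simp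
    moreover have "(LINT s|lebesgue. indicator {x<..} s * G s) = 0" if "x < 0"
    proof -
      have "(LINT s|lebesgue. indicator {x<..} s * G s) = (LINT s|lebesgue. indicator {0..a} s * G s)"
        using that by (intro Bochner_Integration.integral_cong) (auto simp: G_def indicator_def)
      then show ?thesis using G_upto[of a] a by simp
    qed
    ultimately show ?thesis
      using \<open>(LINT s|lborel. indicator {x<..} s * G' s) = (LINT s|lebesgue. indicator {x<..} s * G' s)\<close>
        \<open>(LINT s|lebesgue. indicator {x<..} s * G' s) = (LINT s|lebesgue. indicator {x<..} s * G s)\<close>
      by (cases "x < 0") auto
  qed
  define p n where "p = (\<lambda>s. max 0 (G' s))" and "n = (\<lambda>s. max 0 (- G' s))"
  have [measurable]: "p \<in> borel_measurable lborel" "n \<in> borel_measurable lborel"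
    by (auto simp: p_def n_def)
  have ip: "integrable lborel p" and in': "integrable lborel n"
    unfolding p_def n_def using i by auto
  have em: "emeasure (density lborel (\<lambda>s. ennreal (q s))) {x<..} = ennreal (LINT s|lborel. indicator {x<..} s * q s)"
    if q: "integrable lborel q" "\<And>s. q s \<ge> 0" for q :: "real \<Rightarrow> real" and x
  proof -
    have [measurable]: "q \<in> borel_measurable lborel" using q by simp
    have "emeasure (density lborel (\<lambda>s. ennreal (q s))) {x<..} = (\<integral>\<^sup>+s. ennreal (indicator {x<..} s * q s) \<partial>lborel)"
      by (subst emeasure_density) (auto intro!: nn_integral_cong simp: indicator_def)
    also have "\<dots> = ennreal (LINT s|lborel. indicator {x<..} s * q s)"
      using q integrable_mult_indicator[OF _ q(1), of "{x<..}"]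
      by (intro nn_integral_eq_integral) auto
    finally show ?thesis .
  qed
  have "(LINT s|lborel. indicator {x<..} s * p s) - (LINT s|lborel. indicator {x<..} s * n s) = 0" for x
  proof -
    have "(LINT s|lborel. indicator {x<..} s * p s) - (LINT s|lborel. indicator {x<..} s * n s)
      = (LINT s|lborel. indicator {x<..} s * p s - indicator {x<..} s * n s)"
      using integrable_mult_indicator[OF _ ip, of "{x<..}"] integrable_mult_indicator[OF _ in', of "{x<..}"]
      by (intro Bochner_Integration.integral_diff[symmetric]) auto
    also have "\<dots> = (LINT s|lborel. indicator {x<..} s * G' s)"
      by (intro Bochner_Integration.integral_cong) (auto simp: p_def n_def indicator_def)
    finally show ?thesis using tail by simp
  qed
  then have "density lborel (\<lambda>s. ennreal (p s)) = density lborel (\<lambda>s. ennreal (n s))"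
    using em[OF ip] em[OF in']
    by (intro measure_eqI_lessThan) (auto simp: p_def n_def)
  moreover have "integral\<^sup>N lborel (\<lambda>s. ennreal (p s)) \<noteq> \<infinity>"
    using nn_integral_eq_integral[OF ip] by (simp add: p_def)
  ultimately have "AE s in lborel. ennreal (p s) = ennreal (n s)"
    by (subst (asm) finite_density_unique) auto
  then have "AE s in lborel. G' s = 0"
    by eventually_elim (auto simp: p_def n_def max_def split: if_splits)
  then have "AE s in lebesgue. G' s = 0" by (rule AE_completion)
  with eqL have "AE s in lebesgue. s \<in> {0..a} \<longrightarrow> F s = 0"
    by eventually_elim (auto simp: G_def)
  then show ?thesis by (simp add: AE_restrict_space_iff)
qed

lemma square_integrable_mult:
  assumes "square_integrable a f" "square_integrable a g"
  shows "integrable (lebesgue_on {0..a}) (\<lambda>s. f s * g s)"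
proof (rule Bochner_Integration.integrable_bound)
  show "integrable (lebesgue_on {0..a}) (\<lambda>s. (f s)\<^sup>2 + (g s)\<^sup>2)"
    using assms by (auto simp: square_integrable_def)
  show "(\<lambda>s. f s * g s) \<in> borel_measurable (lebesgue_on {0..a})"
    using assms by (auto simp: square_integrable_def)
  have "\<bar>x * y\<bar> \<le> \<bar>x\<^sup>2 + y\<^sup>2\<bar>" for x y :: real
    using sum_squares_bound[of "\<bar>x\<bar>" "\<bar>y\<bar>"] mult_nonneg_nonneg[of "\<bar>x\<bar>" "\<bar>y\<bar>"]
    unfolding abs_mult power2_abs by linarith
  then show "AE s in lebesgue_on {0..a}. norm (f s * g s) \<le> norm ((f s)\<^sup>2 + (g s)\<^sup>2)" by simp
qed

lemma square_integrable_const: "square_integrable a (\<lambda>_. c)"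
  using finite_measure.integrable_const[OF finite_measure_lebesgue_on_interval]
  by (simp add: square_integrable_def)

lemma square_integrable_imp_integrable:
  assumes "square_integrable a f"
  shows "integrable (lebesgue_on {0..a}) f"
  using square_integrable_mult[OF assms square_integrable_const[of a 1]] by simp

lemma square_integrable_diff:
  assumes "square_integrable a f" "square_integrable a g"
  shows "square_integrable a (\<lambda>s. f s - g s)"
proof -
  have "(\<lambda>s. (f s - g s)\<^sup>2) = (\<lambda>s. (f s)\<^sup>2 + (g s)\<^sup>2 - 2 * (f s * g s))"
    by (auto simp: power2_diff)
  then show ?thesis
    using assms square_integrable_mult[OF assms] by (auto simp: square_integrable_def)
qed

lemma square_integrable_truncate:
  assumes "square_integrable t f" "t \<le> a"
  shows "square_integrable a (\<lambda>s. indicator {0..t} s * f s)"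
proof -
  have "(\<lambda>s. (indicator {0..t} s * f s)\<^sup>2) = (\<lambda>s. indicator {0..t} s * (f s)\<^sup>2)"
    by (auto simp: indicator_def fun_eq_iff)
  then show ?thesis
    using assms(1) by (simp add: square_integrable_def lebesgue_on_subinterval(2,3)[OF assms(2)])
qed

lemma integrable_lebesgue_on_subinterval:
  fixes F :: "real \<Rightarrow> real"
  assumes "integrable (lebesgue_on {0..a}) F" "t \<le> a"
  shows "integrable (lebesgue_on {0..t}) F"
  using integrable_mult_indicator[OF _ assms(1), of "{0..t}"] assms(2)
  by (subst lebesgue_on_subinterval(2)[OF assms(2)]) (auto simp: sets_restrict_space_iff)

text \<open>Pairings can therefore be computed with any derivative at hand instead of the one that
  \<^term>\<open>cm_deriv\<close> chooses.\<close>

lemma has_cm_deriv_unique: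
  assumes "has_cm_deriv a h f" "has_cm_deriv a h g" "0 \<le> a"
  shows "AE s in lebesgue_on {0..a}. f s = g s"
proof -
  have fg: "integrable (lebesgue_on {0..a}) f" "integrable (lebesgue_on {0..a}) g"
    using assms square_integrable_imp_integrable by (auto simp: has_cm_deriv_def)
  have "AE s in lebesgue_on {0..a}. f s - g s = 0"
  proof (rule AE_zero_if_primitive_zero)
    fix t assume t: "t \<in> {0..a}"
    with fg have "integrable (lebesgue_on {0..t}) f" "integrable (lebesgue_on {0..t}) g"
      by (auto intro: integrable_lebesgue_on_subinterval)
    then show "(LINT s|lebesgue_on {0..t}. f s - g s) = 0"
      using assms t by (simp add: has_cm_deriv_def)
  qed (use fg assms in auto)
  then show ?thesis by simp
qed

lemma has_cm_deriv_primitive: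
  "square_integrable a f \<Longrightarrow> has_cm_deriv a (\<lambda>t. integral\<^sup>L (lebesgue_on {0..t}) f) f"
  by (simp add: has_cm_deriv_def)

lemma has_cm_deriv_cm_deriv:
  assumes "h \<in> cm_space a"
  shows "has_cm_deriv a h (cm_deriv a h)"
proof -
  from assms obtain f where "has_cm_deriv a h f" by (auto simp: cm_space_def)
  then show ?thesis unfolding cm_deriv_def
    by (rule someI[where P = "has_cm_deriv a h"])
qed

lemma has_cm_deriv_diff:
  assumes "has_cm_deriv a h f" "has_cm_deriv a h' f'"
  shows "has_cm_deriv a (\<lambda>s. h s - h' s) (\<lambda>s. f s - f' s)"
proof -
  have sq: "square_integrable a f" "square_integrable a f'"
    using assms by (auto simp: has_cm_deriv_def)
  have "h t - h' t = (LINT s|lebesgue_on {0..t}. f s - f' s)" if t: "t \<in> {0..a}" for t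
  proof -
    have "integrable (lebesgue_on {0..t}) f" "integrable (lebesgue_on {0..t}) f'"
      using sq t by (auto intro: integrable_lebesgue_on_subinterval square_integrable_imp_integrable)
    then show ?thesis using assms t by (simp add: has_cm_deriv_def)
  qed
  then show ?thesis using square_integrable_diff[OF sq] by (simp add: has_cm_deriv_def)
qed

lemma cm_inner_eq:
  assumes h: "has_cm_deriv a h f" and g: "has_cm_deriv a g f'" and "0 \<le> a"
  shows "cm_inner a h g = (LINT s|lebesgue_on {0..a}. f s * f' s)"
proof -
  have c: "has_cm_deriv a h (cm_deriv a h)" "has_cm_deriv a g (cm_deriv a g)"
    using h g by (auto intro!: has_cm_deriv_cm_deriv simp: cm_space_def)
  have "AE s in lebesgue_on {0..a}. cm_deriv a h s * cm_deriv a g s = f s * f' s"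
    using has_cm_deriv_unique[OF c(1) h assms(3)] has_cm_deriv_unique[OF c(2) g assms(3)]
    by eventually_elim simp
  then show ?thesis
    unfolding cm_inner_def using h g c
    by (intro integral_cong_AE) (auto simp: has_cm_deriv_def square_integrable_def)
qed

lemma has_cm_deriv_chi:
  assumes "t \<in> {0..a}"
  shows "has_cm_deriv a (chi t) (indicator {0..t})"
proof -
  have "square_integrable a (\<lambda>s. indicator {0..t} s * 1)"
    using assms by (intro square_integrable_truncate square_integrable_const) auto
  moreover have "chi t s = integral\<^sup>L (lebesgue_on {0..s}) (indicator {0..t})" if "s \<in> {0..a}" for s
  proof -
    have "integral\<^sup>L (lebesgue_on {0..s}) (indicator {0..t})
        = (LINT x|lebesgue. indicator {0..s} x *\<^sub>R (indicator {0..t} x :: real))"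
      by (rule integral_restrict_space) simp
    also have "\<dots> = (LINT x|lebesgue. indicator {0..min s t} x)"
      by (intro Bochner_Integration.integral_cong) (auto simp: indicator_def)
    also have "\<dots> = min s t" using that assms by simp
    finally show ?thesis by (simp add: chi_def min.commute)
  qed
  ultimately show ?thesis by (simp add: has_cm_deriv_def)
qed

text \<open>The reproducing property: pairing with \<open>\<chi>\<^sub>t\<close>, whose derivative is the indicator of \<open>{0..t}\<close>,
  integrates the derivative of \<open>g\<close> up to time \<open>t\<close>.\<close>

lemma cm_inner_chi:
  assumes "g \<in> cm_space a" "t \<in> {0..a}"
  shows "cm_inner a (chi t) g = g t"
proof -
  have g: "has_cm_deriv a g (cm_deriv a g)" by (rule has_cm_deriv_cm_deriv[OF assms(1)])
  have "cm_inner a (chi t) g = (LINT s|lebesgue_on {0..a}. indicator {0..t} s * cm_deriv a g s)"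
    using assms by (intro cm_inner_eq has_cm_deriv_chi g) auto
  also have "\<dots> = integral\<^sup>L (lebesgue_on {0..t}) (cm_deriv a g)"
    using assms by (intro lebesgue_on_subinterval(1)[symmetric]) auto
  also have "\<dots> = g t" using g assms by (auto simp: has_cm_deriv_def)
  finally show ?thesis .
qed

text \<open>By the reproducing property the adjoint at \<open>\<chi>\<^sub>t\<close> must represent \<open>h \<mapsto> (K h)(t)\<close>, which is the
  integral of \<open>K(t, \<cdot>)\<close> against the derivative of \<open>h\<close> over \<open>{0..t}\<close>. The primitive of the truncated
  kernel does this, so a representing element exists; any two differ by an element orthogonal to the
  dense domain of \<open>K\<close>, which has derivative zero almost everywhere.\<close>

lemma kernel_op_adjoint_chi:
  assumes K: "admissible_kernel a K" and t: "t \<in> {0..a}"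
  shows "has_cm_deriv a (kernel_op_adjoint a K (chi t)) (\<lambda>s. indicator {0..t} s * K t s)"
    (is "has_cm_deriv a ?k ?f0")
proof -
  have a: "0 \<le> a" using t by simp
  have Kt: "square_integrable t (K t)" using K t by (simp add: admissible_kernel_def)
  have f0: "square_integrable a ?f0" using square_integrable_truncate[OF Kt] t by simp
  define k0 where "k0 = (\<lambda>s. integral\<^sup>L (lebesgue_on {0..s}) ?f0)"
  have k0: "has_cm_deriv a k0 ?f0" unfolding k0_def by (rule has_cm_deriv_primitive[OF f0])
  have target: "cm_inner a (chi t) (kernel_op a K h) = (LINT s|lebesgue_on {0..a}. ?f0 s * cm_deriv a h s)"
    if "h \<in> kernel_op_dom a K" for h
  proof -
    have "cm_inner a (chi t) (kernel_op a K h) = (LINT s|lebesgue_on {0..t}. K t s * cm_deriv a h s)"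
      using that t by (subst cm_inner_chi) (auto simp: kernel_op_dom_def kernel_op_def)
    also have "\<dots> = (LINT s|lebesgue_on {0..a}. indicator {0..t} s * (K t s * cm_deriv a h s))"
      using t by (intro lebesgue_on_subinterval(1)) auto
    finally show ?thesis by (simp add: mult.assoc)
  qed
  have "k0 \<in> cm_space a \<and> (\<forall>h\<in>kernel_op_dom a K. cm_inner a k0 h = cm_inner a (chi t) (kernel_op a K h))"
  proof (intro conjI ballI)
    show "k0 \<in> cm_space a" using k0 by (auto simp: cm_space_def)
    fix h assume h: "h \<in> kernel_op_dom a K"
    then have "has_cm_deriv a h (cm_deriv a h)" by (intro has_cm_deriv_cm_deriv) (simp add: kernel_op_dom_def)
    then show "cm_inner a k0 h = cm_inner a (chi t) (kernel_op a K h)"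
      using target[OF h] cm_inner_eq[OF k0 _ a] by simp
  qed
  then have "?k \<in> cm_space a \<and> (\<forall>h\<in>kernel_op_dom a K. cm_inner a ?k h = cm_inner a (chi t) (kernel_op a K h))"
    unfolding kernel_op_adjoint_def
    by (rule someI[where P = "\<lambda>k. k \<in> cm_space a \<and>
      (\<forall>h\<in>kernel_op_dom a K. cm_inner a k h = cm_inner a (chi t) (kernel_op a K h))"])
  then have kcm: "?k \<in> cm_space a"
    and kad: "\<And>h. h \<in> kernel_op_dom a K \<Longrightarrow> cm_inner a ?k h = cm_inner a (chi t) (kernel_op a K h)" by auto
  define f where "f = cm_deriv a ?k"
  have f: "has_cm_deriv a ?k f" unfolding f_def by (rule has_cm_deriv_cm_deriv[OF kcm])
  define d where "d = (\<lambda>s. f s - ?f0 s)"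
  have dk: "has_cm_deriv a (\<lambda>s. ?k s - k0 s) d"
    unfolding d_def by (rule has_cm_deriv_diff[OF f k0])
  have sd: "square_integrable a d" using dk by (simp add: has_cm_deriv_def)
  have orth: "(LINT s|lebesgue_on {0..a}. d s * cm_deriv a h s) = 0" if h: "h \<in> kernel_op_dom a K" for h
  proof -
    have hd: "has_cm_deriv a h (cm_deriv a h)"
      using h by (intro has_cm_deriv_cm_deriv) (simp add: kernel_op_dom_def)
    then have sh: "square_integrable a (cm_deriv a h)" by (simp add: has_cm_deriv_def)
    have "(LINT s|lebesgue_on {0..a}. f s * cm_deriv a h s) = (LINT s|lebesgue_on {0..a}. ?f0 s * cm_deriv a h s)"
      using kad[OF h] target[OF h] cm_inner_eq[OF f hd a] by simp
    moreover have "integrable (lebesgue_on {0..a}) (\<lambda>s. f s * cm_deriv a h s)"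
      "integrable (lebesgue_on {0..a}) (\<lambda>s. ?f0 s * cm_deriv a h s)"
      using f k0 sh by (auto intro!: square_integrable_mult simp: has_cm_deriv_def simp del: mult.assoc)
    ultimately show ?thesis
      by (simp add: d_def left_diff_distrib)
  qed
  have dense: "\<exists>g\<in>kernel_op_dom a K. cm_inner a (\<lambda>s. h s - g s) (\<lambda>s. h s - g s) < \<epsilon>"
    if "h \<in> cm_space a" "\<epsilon> > 0" for h \<epsilon>
    using K that by (simp add: admissible_kernel_def)
  \<comment> \<open>For \<open>g\<close> in the domain, \<open>d\<close> is orthogonal to \<open>g'\<close>, so \<open>\<parallel>d\<parallel>\<^sup>2 \<le> \<parallel>d\<parallel>\<^sup>2 + \<parallel>g'\<parallel>\<^sup>2 = \<parallel>d - g'\<parallel>\<^sup>2\<close>.\<close>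
  have "(LINT s|lebesgue_on {0..a}. (d s)\<^sup>2) \<le> \<epsilon>" if "\<epsilon> > 0" for \<epsilon>
  proof -
    have "(\<lambda>s. ?k s - k0 s) \<in> cm_space a" using dk by (auto simp: cm_space_def)
    from dense[OF this that] obtain g where g: "g \<in> kernel_op_dom a K"
      and close: "cm_inner a (\<lambda>s. (?k s - k0 s) - g s) (\<lambda>s. (?k s - k0 s) - g s) < \<epsilon>"
      by (elim bexE)
    define g' where "g' = cm_deriv a g"
    have gd: "has_cm_deriv a g g'"
      unfolding g'_def using g by (intro has_cm_deriv_cm_deriv) (simp add: kernel_op_dom_def)
    have sg: "square_integrable a g'" using gd by (simp add: has_cm_deriv_def)
    have dg: "has_cm_deriv a (\<lambda>s. (?k s - k0 s) - g s) (\<lambda>s. d s - g' s)"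
      by (rule has_cm_deriv_diff[OF dk gd])
    have i: "integrable (lebesgue_on {0..a}) (\<lambda>s. (d s)\<^sup>2)" "integrable (lebesgue_on {0..a}) (\<lambda>s. (g' s)\<^sup>2)"
      "integrable (lebesgue_on {0..a}) (\<lambda>s. d s * g' s)"
      using sd sg square_integrable_mult[OF sd sg] by (auto simp: square_integrable_def)
    have "(LINT s|lebesgue_on {0..a}. (d s)\<^sup>2) \<le> (LINT s|lebesgue_on {0..a}. (d s)\<^sup>2 + (g' s)\<^sup>2)"
      using i by (intro integral_mono) auto
    also have "\<dots> = (LINT s|lebesgue_on {0..a}. (d s)\<^sup>2 + (g' s)\<^sup>2 - 2 * (d s * g' s))"
      using i orth[OF g] by (simp add: g'_def)
    also have "\<dots> = (LINT s|lebesgue_on {0..a}. (d s - g' s) * (d s - g' s))"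
      by (intro Bochner_Integration.integral_cong) (auto simp: power2_eq_square algebra_simps)
    also have "\<dots> < \<epsilon>" using close cm_inner_eq[OF dg dg a] by simp
    finally show ?thesis by simp
  qed
  then have "(LINT s|lebesgue_on {0..a}. (d s)\<^sup>2) \<le> 0" by (rule field_le_epsilon[of _ 0, simplified])
  then have "(LINT s|lebesgue_on {0..a}. (d s)\<^sup>2) = 0"
    by (intro antisym Bochner_Integration.integral_nonneg) auto
  then have "AE s in lebesgue_on {0..a}. d s = 0"
    using sd by (subst (asm) integral_nonneg_eq_0_iff_AE) (auto simp: square_integrable_def)
  then have ae: "AE s in lebesgue_on {0..a}. f s = ?f0 s"
    by eventually_elim (simp add: d_def)
  have "integral\<^sup>L (lebesgue_on {0..s}) f = integral\<^sup>L (lebesgue_on {0..s}) ?f0" if s: "s \<in> {0..a}" for s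
  proof -
    have "AE x in lebesgue_on {0..a}. indicator {0..s} x * f x = indicator {0..s} x * ?f0 x"
      using ae by eventually_elim simp
    moreover have "integrable (lebesgue_on {0..s}) f" "integrable (lebesgue_on {0..s}) ?f0"
      using f f0 s by (auto simp: has_cm_deriv_def intro: integrable_lebesgue_on_subinterval square_integrable_imp_integrable)
    ultimately show ?thesis
      using s lebesgue_on_subinterval(1,2)[of s a f] lebesgue_on_subinterval(1,2)[of s a ?f0]
      by (auto intro!: integral_cong_AE)
  qed
  then show ?thesis
    using f f0 by (auto simp: has_cm_deriv_def)
qed

lemma cm_inner_chi_Gamma_op:
  assumes K: "admissible_kernel a K" and t: "t \<in> {0..a}"
  shows "cm_inner a (chi t) (Gamma_op a K (chi t)) = kernel_cov K t t"
proof -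
  let ?f0 = "\<lambda>s. indicator {0..t} s * K t s"
  have a: "0 \<le> a" using t by simp
  define k where "k = kernel_op_adjoint a K (chi t)"
  have k: "has_cm_deriv a k ?f0" unfolding k_def by (rule kernel_op_adjoint_chi[OF assms])
  have k': "has_cm_deriv a k (cm_deriv a k)"
    using k by (intro has_cm_deriv_cm_deriv) (auto simp: cm_space_def)
  have Kt: "square_integrable a ?f0" using k by (simp add: has_cm_deriv_def)
  have "cm_inner a (chi t) (Gamma_op a K (chi t)) = Gamma_op a K (chi t) t"
    using K t by (intro cm_inner_chi) (auto simp: admissible_kernel_def)
  also have "\<dots> = (LINT s|lebesgue_on {0..t}. K t s * cm_deriv a k s)"
    by (simp add: Gamma_op_def kernel_op_def k_def)
  also have "\<dots> = (LINT s|lebesgue_on {0..a}. ?f0 s * cm_deriv a k s)"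
    using t by (subst lebesgue_on_subinterval(1)[of t a]) (auto simp: mult.assoc)
  also have "\<dots> = (LINT s|lebesgue_on {0..a}. ?f0 s * ?f0 s)"
  proof (rule integral_cong_AE)
    show "AE s in lebesgue_on {0..a}. ?f0 s * cm_deriv a k s = ?f0 s * ?f0 s"
      using has_cm_deriv_unique[OF k' k a] by eventually_elim simp
  qed (use Kt k' in \<open>auto simp: has_cm_deriv_def square_integrable_def\<close>)
  also have "\<dots> = (LINT s|lebesgue_on {0..a}. indicator {0..t} s * (K t s * K t s))"
    by (intro Bochner_Integration.integral_cong) (auto simp: indicator_def)
  also have "\<dots> = kernel_cov K t t"
    using t by (subst lebesgue_on_subinterval(1)[of t a, symmetric]) (auto simp: kernel_cov_def)
  finally show ?thesis .
qed

section \<open>Centered Gaussian processes\<close>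

text \<open>Centering reduces the two kinds of Gaussian law to a scaled standard normal law and the Dirac mass
  at \<open>0\<close>, for which the variance and the characteristic function are known.\<close>

lemma gaussian_law_centered:
  assumes N: "gaussian_law N" and mean: "(LINT x|N. x) = 0"
  shows "integrable N (\<lambda>x. x\<^sup>2)" and "char N 1 = complex_of_real (exp (- (LINT x|N. x\<^sup>2) / 2))"
proof -
  have "integrable N (\<lambda>x. x\<^sup>2) \<and> char N 1 = complex_of_real (exp (- (LINT x|N. x\<^sup>2) / 2))"
    using N unfolding gaussian_law_def
  proof (elim disjE exE conjE)
    fix m \<sigma> :: real assume \<sigma>: "\<sigma> > 0" and Nd: "N = density lborel (\<lambda>x. ennreal (normal_density m \<sigma> x))"
    have "(LINT x|N. x) = m"
      unfolding Nd using integral_normal_moment_nz_1[OF \<sigma>, of m]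
      by (subst integral_density) (auto simp: normal_density_nonneg)
    with mean have m: "m = 0" by simp
    have i2: "integrable N (\<lambda>x. x\<^sup>2)"
      using integrable_normal_moment[OF \<sigma>, of m 2]
      unfolding Nd by (subst integrable_density) (auto simp: normal_density_nonneg m)
    have var: "(LINT x|N. x\<^sup>2) = \<sigma>\<^sup>2"
      unfolding Nd using integral_normal_moment_even[OF \<sigma>, of m 1]
      by (subst integral_density) (auto simp: normal_density_nonneg m numeral_2_eq_2)
    let ?S = std_normal_distribution
    interpret S: prob_space ?S by (rule prob_space_normal_density) simp
    have "distributed ?S lborel (\<lambda>x. x) std_normal_density"
      by (auto simp: distributed_def distr_id2)
    from S.normal_density_affine[OF this _ , of \<sigma> 0] \<sigma>
    have "distributed ?S lborel (\<lambda>x. \<sigma> * x) (normal_density 0 \<sigma>)" by simp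
    then have "distr ?S lborel (\<lambda>x. \<sigma> * x) = N"
      unfolding Nd m by (rule distributed_distr_eq_density)
    then have "char N 1 = (CLINT x|distr ?S lborel (\<lambda>x. \<sigma> * x). iexp (1 * x))"
      by (simp add: char_def)
    also have "\<dots> = char ?S \<sigma>"
      unfolding char_def by (subst integral_distr) auto
    finally show ?thesis
      using i2 by (simp add: var char_std_normal_distribution)
  next
    fix m :: real assume Nr: "N = return borel m"
    have ret: "integral\<^sup>L N f = f m" if "f \<in> borel_measurable borel"
      for f :: "real \<Rightarrow> 'b::{banach, second_countable_topology}"
      using that unfolding Nr by (intro integral_return) auto
    have "m = 0" using mean ret[of "\<lambda>x. x"] by simp
    then have "char N 1 = 1" using ret[of "\<lambda>x. iexp (1 * x)"] by (simp add: char_def)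
    moreover have "(LINT x|N. x\<^sup>2) = 0" using ret[of "\<lambda>x. x\<^sup>2"] \<open>m = 0\<close> by simp
    moreover have "integrable N (\<lambda>x. x\<^sup>2)"
      unfolding integrable_iff_bounded using Nr by (simp add: nn_integral_return)
    ultimately show ?thesis by simp
  qed
  then show "integrable N (\<lambda>x. x\<^sup>2)" "char N 1 = complex_of_real (exp (- (LINT x|N. x\<^sup>2) / 2))" by auto
qed

context
  fixes M :: "'a measure" and I :: "real set" and \<gamma> Y
  assumes gp: "centered_gaussian_process M I \<gamma> Y"
begin

lemma gp_prob_space: "prob_space M"
  and gp_measurable: "\<forall>t\<in>I. Y t \<in> borel_measurable M"
  and gp_gaussian: "\<forall>J c. finite J \<and> J \<subseteq> I \<longrightarrow> gaussian_law (distr M borel (\<lambda>\<omega>. \<Sum>t\<in>J. c t * Y t \<omega>))"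
  and gp_mean: "\<forall>t\<in>I. (LINT \<omega>|M. Y t \<omega>) = 0"
  and gp_cov: "\<forall>s\<in>I. \<forall>t\<in>I. (LINT \<omega>|M. Y s \<omega> * Y t \<omega>) = \<gamma> s t"
  using gp unfolding centered_gaussian_process_def by - (elim conjE, assumption)+

lemma centered_gaussian_process_square_integrable:
  assumes "t \<in> I"
  shows "integrable M (\<lambda>\<omega>. (Y t \<omega>)\<^sup>2)" and "integrable M (Y t)"
proof -
  interpret prob_space M by (rule gp_prob_space)
  have [measurable]: "Y t \<in> borel_measurable M" using gp_measurable assms by (rule bspec)
  have "gaussian_law (distr M borel (\<lambda>\<omega>. \<Sum>t\<in>{t}. 1 * Y t \<omega>))"
    using assms by (intro gp_gaussian[THEN spec, THEN spec, THEN mp]) auto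
  moreover have "(LINT x|distr M borel (\<lambda>\<omega>. \<Sum>t\<in>{t}. 1 * Y t \<omega>). x) = 0"
    using bspec[OF gp_mean assms] by (subst integral_distr) auto
  ultimately have "integrable (distr M borel (\<lambda>\<omega>. \<Sum>t\<in>{t}. 1 * Y t \<omega>)) (\<lambda>x. x\<^sup>2)"
    by (rule gaussian_law_centered(1))
  then show *: "integrable M (\<lambda>\<omega>. (Y t \<omega>)\<^sup>2)"
    by (subst (asm) integrable_distr_eq) auto
  have "\<bar>x\<bar> \<le> 1 + x\<^sup>2" for x :: real
    using sum_squares_bound[of "\<bar>x\<bar>" 1] by (simp add: power2_eq_square)
  with * show "integrable M (Y t)"
    by (intro Bochner_Integration.integrable_bound[of M "\<lambda>\<omega>. 1 + (Y t \<omega>)\<^sup>2" "Y t"]) auto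
qed

text \<open>A linear combination of the process is Gaussian and centered, so its characteristic function at
  \<open>1\<close> is given by its variance, which expands bilinearly.\<close>

lemma centered_gaussian_process_char:
  assumes J: "finite J" "J \<subseteq> I"
  shows "(CLINT \<omega>|M. iexp (\<Sum>t\<in>J. c t * Y t \<omega>))
    = complex_of_real (exp (- (\<Sum>s\<in>J. \<Sum>t\<in>J. c s * c t * \<gamma> s t) / 2))"
proof -
  let ?Z = "\<lambda>\<omega>. \<Sum>t\<in>J. c t * Y t \<omega>"
  have mY: "Y t \<in> borel_measurable M" if "t \<in> I" for t using gp_measurable that by (rule bspec)
  have [measurable]: "?Z \<in> borel_measurable M"
    using J mY by (intro borel_measurable_sum borel_measurable_times) auto
  have i: "integrable M (\<lambda>\<omega>. Y s \<omega> * Y t \<omega>)" if "s \<in> I" "t \<in> I" for s t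
  proof (rule Bochner_Integration.integrable_bound)
    show "integrable M (\<lambda>\<omega>. (Y s \<omega>)\<^sup>2 + (Y t \<omega>)\<^sup>2)"
      using that by (intro Bochner_Integration.integrable_add centered_gaussian_process_square_integrable)
    have "\<bar>x * y\<bar> \<le> \<bar>x\<^sup>2 + y\<^sup>2\<bar>" for x y :: real
      using sum_squares_bound[of "\<bar>x\<bar>" "\<bar>y\<bar>"] mult_nonneg_nonneg[of "\<bar>x\<bar>" "\<bar>y\<bar>"]
      unfolding abs_mult power2_abs by linarith
    then show "AE \<omega> in M. norm (Y s \<omega> * Y t \<omega>) \<le> norm ((Y s \<omega>)\<^sup>2 + (Y t \<omega>)\<^sup>2)" by simp
  qed (use that mY in auto)
  have g: "gaussian_law (distr M borel ?Z)"
    using J by (intro gp_gaussian[THEN spec, THEN spec, THEN mp] conjI)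
  have "(LINT \<omega>|M. ?Z \<omega>) = (\<Sum>t\<in>J. c t * (LINT \<omega>|M. Y t \<omega>))"
    using J centered_gaussian_process_square_integrable(2)
    by (subst Bochner_Integration.integral_sum) auto
  also have "\<dots> = 0"
    using J bspec[OF gp_mean] by (intro sum.neutral ballI) (simp add: subset_eq)
  finally have mean: "(LINT x|distr M borel ?Z. x) = 0" by (simp add: integral_distr)
  have "(LINT x|distr M borel ?Z. x\<^sup>2) = (LINT \<omega>|M. (?Z \<omega>)\<^sup>2)" by (simp add: integral_distr)
  also have "\<dots> = (LINT \<omega>|M. (\<Sum>s\<in>J. \<Sum>t\<in>J. c s * c t * (Y s \<omega> * Y t \<omega>)))"
    by (simp add: power2_eq_square sum_product mult_ac)
  also have "\<dots> = (\<Sum>s\<in>J. \<Sum>t\<in>J. c s * c t * (LINT \<omega>|M. Y s \<omega> * Y t \<omega>))"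
  proof -
    have ic: "integrable M (\<lambda>\<omega>. c s * c t * (Y s \<omega> * Y t \<omega>))" if "s \<in> J" "t \<in> J" for s t
      using i[of s t] that J by auto
    have "(LINT \<omega>|M. (\<Sum>s\<in>J. \<Sum>t\<in>J. c s * c t * (Y s \<omega> * Y t \<omega>)))
        = (\<Sum>s\<in>J. LINT \<omega>|M. (\<Sum>t\<in>J. c s * c t * (Y s \<omega> * Y t \<omega>)))"
      by (intro Bochner_Integration.integral_sum Bochner_Integration.integrable_sum ic)
    also have "\<dots> = (\<Sum>s\<in>J. \<Sum>t\<in>J. LINT \<omega>|M. c s * c t * (Y s \<omega> * Y t \<omega>))"
      by (intro sum.cong refl Bochner_Integration.integral_sum ic)
    finally show ?thesis by simp
  qed
  also have "\<dots> = (\<Sum>s\<in>J. \<Sum>t\<in>J. c s * c t * \<gamma> s t)"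
    using J(2) by (intro sum.cong refl arg_cong2[where f = "(*)"] gp_cov[THEN bspec, THEN bspec]) auto
  finally have "char (distr M borel ?Z) 1 = complex_of_real (exp (- (\<Sum>s\<in>J. \<Sum>t\<in>J. c s * c t * \<gamma> s t) / 2))"
    using gaussian_law_centered(2)[OF g mean] by simp
  then show ?thesis
    unfolding char_def by (subst (asm) integral_distr) auto
qed

text \<open>The cross term vanishes because the process is centered. Stated with a constant \<open>b\<close>, this also
  evaluates the inner integral of an iterated integral, in which the other variable is constant.\<close>

lemma centered_gaussian_process_second_moment:
  assumes t: "t \<in> I"
  shows "(\<integral>\<^sup>+\<omega>. ennreal ((b - a * Y t \<omega>)\<^sup>2) \<partial>M) = ennreal (b\<^sup>2 + a\<^sup>2 * \<gamma> t t)"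
proof -
  interpret prob_space M by (rule gp_prob_space)
  note i = centered_gaussian_process_square_integrable[OF t]
  have e: "(b - a * Y t \<omega>)\<^sup>2 = b\<^sup>2 + a\<^sup>2 * (Y t \<omega>)\<^sup>2 - 2 * a * b * Y t \<omega>" for \<omega>
    by (simp add: power2_diff power_mult_distrib)
  have m: "(LINT \<omega>|M. Y t \<omega>) = 0" "(LINT \<omega>|M. (Y t \<omega>)\<^sup>2) = \<gamma> t t"
    using bspec[OF gp_mean t] bspec[OF bspec[OF gp_cov t] t] by (simp_all add: power2_eq_square)
  have "(\<integral>\<^sup>+\<omega>. ennreal ((b - a * Y t \<omega>)\<^sup>2) \<partial>M) = ennreal (LINT \<omega>|M. (b - a * Y t \<omega>)\<^sup>2)"
  proof (rule nn_integral_eq_integral)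
    show "integrable M (\<lambda>\<omega>. (b - a * Y t \<omega>)\<^sup>2)" unfolding e using i by auto
  qed simp
  also have "(LINT \<omega>|M. (b - a * Y t \<omega>)\<^sup>2) = b\<^sup>2 + a\<^sup>2 * \<gamma> t t"
    unfolding e using i m by (simp add: prob_space)
  finally show ?thesis .
qed

lemma centered_gaussian_process_variance_nonneg:
  assumes "t \<in> I"
  shows "0 \<le> \<gamma> t t"
proof -
  have "0 \<le> (LINT \<omega>|M. Y t \<omega> * Y t \<omega>)" by (rule Bochner_Integration.integral_nonneg) simp
  then show ?thesis using bspec[OF bspec[OF gp_cov assms] assms] by simp
qed

end

section \<open>Measurability on path space\<close>

lemma space_path_space: "space (path_space T) = {\<omega> \<in> extensional {0..T}. continuous_on {0..T} \<omega>}"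
  by (auto simp: path_space_def space_restrict_space space_PiM PiE_def)

lemma measurable_coordinate:
  "t \<in> {0..T} \<Longrightarrow> (\<lambda>\<omega>. \<omega> t) \<in> borel_measurable (path_space T)"
  unfolding path_space_def by (intro measurable_restrict_space1 measurable_component_singleton)

lemma measurable_into_path_space:
  assumes "\<And>x. x \<in> space M \<Longrightarrow> f x \<in> space (path_space T)"
    and "\<And>t. t \<in> {0..T} \<Longrightarrow> (\<lambda>x. f x t) \<in> borel_measurable M"
  shows "f \<in> M \<rightarrow>\<^sub>M path_space T"
  unfolding path_space_def
proof (rule measurable_restrict_space2)
  show "f \<in> space M \<rightarrow> {\<omega>. continuous_on {0..T} \<omega>}"
    using assms(1) by (auto simp: space_path_space)
  have "(\<lambda>x. \<lambda>t\<in>{0..T}. f x t) \<in> M \<rightarrow>\<^sub>M (\<Pi>\<^sub>M t\<in>{0..T}. borel)"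
    using assms(2) by (rule measurable_restrict)
  also have "?this \<longleftrightarrow> f \<in> M \<rightarrow>\<^sub>M (\<Pi>\<^sub>M t\<in>{0..T}. borel)"
    using assms(1) by (intro measurable_cong) (auto simp: space_path_space extensional_restrict)
  finally show "f \<in> M \<rightarrow>\<^sub>M (\<Pi>\<^sub>M t\<in>{0..T}. borel)" .
qed

text \<open>By continuity of the paths, \<open>\<omega> t\<close> is the limit of the values of \<open>\<omega>\<close> at grid points
  approaching \<open>t\<close> from below, and evaluation at a grid point that depends measurably on \<open>t\<close> is a
  countable case distinction.\<close>

lemma measurable_coordinate_process:
  "(\<lambda>(t, \<omega>). \<omega> t) \<in> borel_measurable (restrict_space borel {0..T} \<Otimes>\<^sub>M path_space T)"
proof (cases "0 \<le> T")
  case True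
  let ?N = "restrict_space borel {0..T} \<Otimes>\<^sub>M path_space T"
  \<comment> \<open>Grid points \<open>\<lfloor>(n + 1) t\<rfloor> / (n + 1)\<close>; the minimum makes every index \<open>i\<close> give a point of \<open>{0..T}\<close>.\<close>
  define r where "r n t = min T (real (nat \<lfloor>real (Suc n) * t\<rfloor>) / real (Suc n))" for n t
  have r: "r n t \<in> {0..T}" for n t using True by (simp add: r_def)
  have fst_meas[measurable]: "fst \<in> borel_measurable ?N"
    by (rule measurable_compose[OF measurable_fst]) (rule measurable_restrict_space1, simp)
  have "(\<lambda>p. snd p (r n (fst p))) \<in> borel_measurable ?N" for n
    unfolding r_def
  proof (rule measurable_compose_countable[where g = "\<lambda>p. nat \<lfloor>real (Suc n) * fst p\<rfloor>"])
    show "(\<lambda>p. snd p (min T (real i / real (Suc n)))) \<in> borel_measurable ?N" for i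
      using True by (intro measurable_compose[OF measurable_snd] measurable_coordinate) auto
    show "(\<lambda>p. nat \<lfloor>real (Suc n) * fst p\<rfloor>) \<in> ?N \<rightarrow>\<^sub>M count_space UNIV" by measurable
  qed
  moreover have "(\<lambda>n. snd p (r n (fst p))) \<longlonglongrightarrow> snd p (fst p)" if p: "p \<in> space ?N" for p
  proof -
    obtain t \<omega> where tp: "p = (t, \<omega>)" and t: "t \<in> {0..T}" and \<omega>: "continuous_on {0..T} \<omega>"
      using p by (cases p) (auto simp: space_pair_measure space_path_space space_restrict_space)
    have "(\<lambda>n. r n t) \<longlonglongrightarrow> t"
    proof (rule real_tendsto_sandwich)
      show "\<forall>\<^sub>F n in sequentially. t - 1 / real (Suc n) \<le> r n t"
      proof (intro always_eventually allI)
        fix n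
        have "real (Suc n) * t - 1 \<le> real (nat \<lfloor>real (Suc n) * t\<rfloor>)" by linarith
        then have "(real (Suc n) * t - 1) / real (Suc n) \<le> real (nat \<lfloor>real (Suc n) * t\<rfloor>) / real (Suc n)"
          by (rule divide_right_mono) simp
        then have "t - 1 / real (Suc n) \<le> real (nat \<lfloor>real (Suc n) * t\<rfloor>) / real (Suc n)"
          by (simp add: diff_divide_distrib)
        moreover have "t - 1 / real (Suc n) \<le> T"
          using t by (smt (verit) atLeastAtMost_iff divide_nonneg_nonneg of_nat_0_le_iff)
        ultimately show "t - 1 / real (Suc n) \<le> r n t" by (simp add: r_def)
      qed
      show "\<forall>\<^sub>F n in sequentially. r n t \<le> t"
      proof (intro always_eventually allI)
        fix n
        have "0 \<le> real (Suc n) * t" using t by simp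
        then have "real (nat \<lfloor>real (Suc n) * t\<rfloor>) \<le> real (Suc n) * t" by linarith
        then have "real (nat \<lfloor>real (Suc n) * t\<rfloor>) / real (Suc n) \<le> t"
          by (simp add: divide_le_eq mult.commute)
        then show "r n t \<le> t" by (simp add: r_def)
      qed
      show "(\<lambda>n. t - 1 / real (Suc n)) \<longlonglongrightarrow> t"
        using tendsto_diff[OF tendsto_const LIMSEQ_inverse_real_of_nat, of t] by (simp add: inverse_eq_divide)
    qed simp
    then show ?thesis
      using continuous_on_tendsto_compose[OF \<omega>, of "\<lambda>n. r n t" t] t r by (simp add: tp)
  qed
  ultimately have "(\<lambda>p. snd p (fst p)) \<in> borel_measurable ?N"
    by (rule borel_measurable_LIMSEQ_real[where u = "\<lambda>n p. snd p (r n (fst p))", rotated])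
  then show ?thesis by (simp add: case_prod_beta')
next
  case False
  then have "space (restrict_space borel {0..T} \<Otimes>\<^sub>M path_space T) = {}"
    by (simp add: space_pair_measure space_restrict_space)
  then show ?thesis by (auto simp: measurable_def)
qed

lemma sets_path_space_least:
  assumes sp: "space M' = space (path_space T)"
    and meas: "\<And>t. t \<in> {0..T} \<Longrightarrow> (\<lambda>\<omega>. \<omega> t) \<in> borel_measurable M'"
  shows "sets (path_space T) \<subseteq> sets M'"
proof
  fix A assume A: "A \<in> sets (path_space T)"
  have "(\<lambda>\<omega>. \<omega>) \<in> M' \<rightarrow>\<^sub>M path_space T"
    using sp meas by (intro measurable_into_path_space) auto
  then have "(\<lambda>\<omega>. \<omega>) -` A \<inter> space M' \<in> sets M'" using A by (rule measurable_sets)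
  moreover have "(\<lambda>\<omega>. \<omega>) -` A \<inter> space M' = A" using sets.sets_into_space[OF A] sp by auto
  ultimately show "A \<in> sets M'" by simp
qed

text \<open>The sum, the scaling and both components of the reflection are linear combinations of two paths;
  the restriction to \<open>{0..T}\<close> keeps the result in path space.\<close>

definition path_comb :: "real \<Rightarrow> real \<Rightarrow> real \<Rightarrow> (real \<Rightarrow> real) \<Rightarrow> (real \<Rightarrow> real) \<Rightarrow> real \<Rightarrow> real" where
  "path_comb T \<alpha> \<beta> y z = (\<lambda>t\<in>{0..T}. \<alpha> * y t + \<beta> * z t)"

lemma path_comb_apply: "t \<in> {0..T} \<Longrightarrow> path_comb T \<alpha> \<beta> y z t = \<alpha> * y t + \<beta> * z t"
  by (simp add: path_comb_def)

lemma path_comb_in_path_space: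
  assumes "y \<in> space (path_space T)" "z \<in> space (path_space T)"
  shows "path_comb T \<alpha> \<beta> y z \<in> space (path_space T)"
proof -
  have "continuous_on {0..T} (\<lambda>t. \<alpha> * y t + \<beta> * z t)"
    using assms by (intro continuous_intros) (auto simp: space_path_space)
  then have "continuous_on {0..T} (path_comb T \<alpha> \<beta> y z)"
    by (rule continuous_on_cong[THEN iffD1, rotated 2]) (auto simp: path_comb_apply)
  then show ?thesis by (simp add: space_path_space path_comb_def)
qed

lemma measurable_path_comb:
  assumes f: "f \<in> M \<rightarrow>\<^sub>M path_space T" and g: "g \<in> M \<rightarrow>\<^sub>M path_space T"
  shows "(\<lambda>x. path_comb T \<alpha> \<beta> (f x) (g x)) \<in> M \<rightarrow>\<^sub>M path_space T"
proof (rule measurable_into_path_space)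
  show "path_comb T \<alpha> \<beta> (f x) (g x) \<in> space (path_space T)" if "x \<in> space M" for x
    using that f g by (intro path_comb_in_path_space) (auto dest: measurable_space)
  fix t assume t: "t \<in> {0..T}"
  have "(\<lambda>x. f x t) \<in> borel_measurable M" "(\<lambda>x. g x t) \<in> borel_measurable M"
    by (rule measurable_compose[OF f measurable_coordinate[OF t]],
        rule measurable_compose[OF g measurable_coordinate[OF t]])
  then show "(\<lambda>x. path_comb T \<alpha> \<beta> (f x) (g x) t) \<in> borel_measurable M"
    using t by (simp add: path_comb_apply)
qed

section \<open>Gaussian laws on path space\<close>

lemma drifted_gaussian_law_basics:
  assumes "drifted_gaussian_law T \<gamma> v M"
  shows "prob_space M" and "sets M = sets (path_space T)" and "space M = space (path_space T)"
    and "centered_gaussian_process M {0..T} \<gamma> (\<lambda>t \<omega>. \<omega> t - v t)"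
  using assms sets_eq_imp_space_eq by (auto simp: drifted_gaussian_law_def centered_gaussian_process_def)

lemma drifted_gaussian_law_char:
  assumes M: "drifted_gaussian_law T \<gamma> v M" and J: "finite J" "J \<subseteq> {0..T}"
  shows "(CLINT \<omega>|M. iexp (\<Sum>t\<in>J. c t * \<omega> t))
    = iexp (\<Sum>t\<in>J. c t * v t) * complex_of_real (exp (- (\<Sum>s\<in>J. \<Sum>t\<in>J. c s * c t * \<gamma> s t) / 2))"
proof -
  have gp: "centered_gaussian_process M {0..T} \<gamma> (\<lambda>t \<omega>. \<omega> t - v t)"
    using M by (simp add: drifted_gaussian_law_def)
  have e: "iexp (\<Sum>t\<in>J. c t * \<omega> t) = iexp (\<Sum>t\<in>J. c t * v t) * iexp (\<Sum>t\<in>J. c t * (\<omega> t - v t))" for \<omega> :: "real \<Rightarrow> real"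
  proof -
    have "(\<Sum>t\<in>J. c t * \<omega> t) = (\<Sum>t\<in>J. c t * v t) + (\<Sum>t\<in>J. c t * (\<omega> t - v t))"
      by (simp add: sum.distrib[symmetric] algebra_simps)
    then show ?thesis by (simp only: of_real_add distrib_left exp_add)
  qed
  have "(CLINT \<omega>|M. iexp (\<Sum>t\<in>J. c t * \<omega> t))
      = (CLINT \<omega>|M. iexp (\<Sum>t\<in>J. c t * v t) * iexp (\<Sum>t\<in>J. c t * (\<omega> t - v t)))"
    by (rule Bochner_Integration.integral_cong[OF refl e])
  then show ?thesis
    using centered_gaussian_process_char[OF gp J, of c] by (simp only: integral_mult_right_zero)
qed

text \<open>Adding \<open>v\<close> multiplies the characteristic function of a linear functional by the phase of its value
  at \<open>v\<close>. The law with drift \<open>v\<close> has the same characteristic functions as the translate and hence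
  equals it. In particular these laws depend measurably on the drift, which the averaging over
  random drifts requires.\<close>

lemma drifted_gaussian_law_shift:
  assumes M: "drifted_gaussian_law T \<gamma> v M" and N: "drifted_gaussian_law T \<gamma> u N"
    and u: "\<forall>t\<in>{0..T}. u t = 0" and v: "v \<in> space (path_space T)"
  shows "M = distr N (path_space T) (\<lambda>\<omega>. path_comb T 1 1 \<omega> v)"
proof -
  note Mb = drifted_gaussian_law_basics[OF M] and Nb = drifted_gaussian_law_basics[OF N]
  interpret M: prob_space M by (rule Mb)
  interpret N: prob_space N by (rule Nb)
  have shift: "(\<lambda>\<omega>. path_comb T 1 1 \<omega> v) \<in> N \<rightarrow>\<^sub>M path_space T"
    using v Nb(2) by (intro measurable_path_comb) (auto intro: measurable_ident_sets)
  show ?thesis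
  proof (rule measure_eqI_vector_family[where X = "\<lambda>t \<omega>. \<omega> t" and I = "{0..T}"])
    show "finite_measure M" by unfold_locales
    show "finite_measure (distr N (path_space T) (\<lambda>\<omega>. path_comb T 1 1 \<omega> v))"
      using shift by (rule N.finite_measure_distr)
    show "sets M = sets (distr N (path_space T) (\<lambda>\<omega>. path_comb T 1 1 \<omega> v))" using Mb(2) by simp
    show "(\<lambda>\<omega>. \<omega> t) \<in> borel_measurable M" if "t \<in> {0..T}" for t
      using measurable_coordinate[OF that] measurable_cong_sets[OF Mb(2) refl] by blast
    show "sets M \<subseteq> sets M'"
      if "space M' = space M" "\<And>t. t \<in> {0..T} \<Longrightarrow> (\<lambda>\<omega>. \<omega> t) \<in> borel_measurable M'" for M'
      using sets_path_space_least[of M' T] that Mb by simp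
    fix J c assume J: "finite J" "J \<subseteq> {0..T}"
    let ?V = "complex_of_real (exp (- (\<Sum>s\<in>J. \<Sum>t\<in>J. c s * c t * \<gamma> s t) / 2))"
    have "(\<lambda>\<omega>. iexp (\<Sum>t\<in>J. c t * \<omega> t)) \<in> borel_measurable (path_space T)"
    proof -
      have "(\<lambda>\<omega>. \<Sum>t\<in>J. c t * \<omega> t) \<in> borel_measurable (path_space T)"
        using J by (intro borel_measurable_sum borel_measurable_times measurable_const measurable_coordinate) auto
      then show ?thesis by measurable
    qed
    then have "(CLINT \<omega>|distr N (path_space T) (\<lambda>\<omega>. path_comb T 1 1 \<omega> v). iexp (\<Sum>t\<in>J. c t * \<omega> t))
      = (CLINT \<omega>|N. iexp (\<Sum>t\<in>J. c t * path_comb T 1 1 \<omega> v t))"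
      by (rule integral_distr[OF shift])
    also have "\<dots> = (CLINT \<omega>|N. iexp (\<Sum>t\<in>J. c t * v t) * iexp (\<Sum>t\<in>J. c t * \<omega> t))"
    proof (rule Bochner_Integration.integral_cong[OF refl])
      fix \<omega> :: "real \<Rightarrow> real"
      have "(\<Sum>t\<in>J. c t * path_comb T 1 1 \<omega> v t) = (\<Sum>t\<in>J. c t * v t) + (\<Sum>t\<in>J. c t * \<omega> t)"
        unfolding sum.distrib[symmetric] using J
        by (intro sum.cong) (auto simp: path_comb_apply algebra_simps subset_eq)
      then show "iexp (\<Sum>t\<in>J. c t * path_comb T 1 1 \<omega> v t) = iexp (\<Sum>t\<in>J. c t * v t) * iexp (\<Sum>t\<in>J. c t * \<omega> t)"
        by (simp only: of_real_add distrib_left exp_add)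
    qed
    also have "\<dots> = iexp (\<Sum>t\<in>J. c t * v t) * (iexp (\<Sum>t\<in>J. c t * u t) * ?V)"
      using drifted_gaussian_law_char[OF N J, of c] by (simp only: integral_mult_right_zero)
    also have "(\<Sum>t\<in>J. c t * u t) = 0" using J u by (intro sum.neutral) auto
    finally show "(CLINT \<omega>|M. iexp (\<Sum>t\<in>J. c t \<bullet> \<omega> t)) =
        (CLINT \<omega>|distr N (path_space T) (\<lambda>\<omega>. path_comb T 1 1 \<omega> v). iexp (\<Sum>t\<in>J. c t \<bullet> \<omega> t))"
      using drifted_gaussian_law_char[OF M J, of c] by (simp add: inner_real_def)
  qed
qed

section \<open>Independent pairs of Gaussian paths\<close>

lemma sets_pair_path_space_least:
  assumes sp: "space M' = space (path_space T \<Otimes>\<^sub>M path_space T)"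
    and meas: "\<And>t. t \<in> {0..T} \<Longrightarrow> (\<lambda>p. (fst p t, snd p t)) \<in> borel_measurable M'"
  shows "sets (path_space T \<Otimes>\<^sub>M path_space T) \<subseteq> sets M'"
proof
  let ?W = "path_space T \<Otimes>\<^sub>M path_space T"
  fix A assume A: "A \<in> sets ?W"
  have "fst \<in> M' \<rightarrow>\<^sub>M path_space T"
  proof (rule measurable_into_path_space)
    show "(\<lambda>p. fst p t) \<in> borel_measurable M'" if "t \<in> {0..T}" for t
      using measurable_compose[OF meas[OF that], of fst borel] by (simp add: borel_prod[symmetric])
  qed (auto simp: sp space_pair_measure)
  moreover have "snd \<in> M' \<rightarrow>\<^sub>M path_space T"
  proof (rule measurable_into_path_space)
    show "(\<lambda>p. snd p t) \<in> borel_measurable M'" if "t \<in> {0..T}" for t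
      using measurable_compose[OF meas[OF that], of snd borel] by (simp add: borel_prod[symmetric])
  qed (auto simp: sp space_pair_measure)
  ultimately have "(\<lambda>p. (fst p, snd p)) \<in> M' \<rightarrow>\<^sub>M ?W" by (rule measurable_Pair)
  then have "(\<lambda>p. (fst p, snd p)) -` A \<inter> space M' \<in> sets M'" using A by (rule measurable_sets)
  moreover have "(\<lambda>p. (fst p, snd p)) -` A \<inter> space M' = A" using sets.sets_into_space[OF A] sp by auto
  ultimately show "A \<in> sets M'" by simp
qed

context
  fixes T :: real and \<gamma> u N Q
  assumes N: "drifted_gaussian_law T \<gamma> u N"
  defines "Q \<equiv> N \<Otimes>\<^sub>M N"
begin

interpretation N: prob_space N by (rule drifted_gaussian_law_basics[OF N])
interpretation NN: pair_prob_space N N ..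

lemma sets_gaussian_pair: "sets Q = sets (path_space T \<Otimes>\<^sub>M path_space T)"
  unfolding Q_def using drifted_gaussian_law_basics(2)[OF N] by (intro sets_pair_measure_cong)

lemma gaussian_pair_measurable_fst: "fst \<in> Q \<rightarrow>\<^sub>M path_space T"
  and gaussian_pair_measurable_snd: "snd \<in> Q \<rightarrow>\<^sub>M path_space T"
  unfolding measurable_cong_sets[OF sets_gaussian_pair refl] by simp_all

text \<open>The characteristic function of an independent pair factors, and the two exponents combine into one
  that involves the coefficients only through their inner products in the plane.\<close>

lemma gaussian_pair_char:
  fixes c :: "real \<Rightarrow> real \<times> real"
  assumes u: "\<forall>t\<in>{0..T}. u t = 0" and J: "finite J" "J \<subseteq> {0..T}"
  shows "(CLINT p|Q. iexp (\<Sum>t\<in>J. c t \<bullet> (fst p t, snd p t)))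
    = complex_of_real (exp (- (\<Sum>s\<in>J. \<Sum>t\<in>J. (c s \<bullet> c t) * \<gamma> s t) / 2))"
proof -
  let ?A = "\<lambda>y. iexp (\<Sum>t\<in>J. fst (c t) * y t)" and ?B = "\<lambda>z. iexp (\<Sum>t\<in>J. snd (c t) * z t)"
  have e: "iexp (\<Sum>t\<in>J. c t \<bullet> (fst p t, snd p t)) = ?A (fst p) * ?B (snd p)" for p :: "(real \<Rightarrow> real) \<times> (real \<Rightarrow> real)"
  proof -
    have "(\<Sum>t\<in>J. c t \<bullet> (fst p t, snd p t)) = (\<Sum>t\<in>J. fst (c t) * fst p t) + (\<Sum>t\<in>J. snd (c t) * snd p t)"
      by (simp add: inner_prod_def sum.distrib)
    then show ?thesis by (simp only: of_real_add distrib_left exp_add)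
  qed
  have meas: "(\<lambda>p. (\<Sum>t\<in>J. r t * fst p t)) \<in> borel_measurable Q" "(\<lambda>p. (\<Sum>t\<in>J. r t * snd p t)) \<in> borel_measurable Q" for r
    using J measurable_compose[OF gaussian_pair_measurable_fst measurable_coordinate]
      measurable_compose[OF gaussian_pair_measurable_snd measurable_coordinate]
    by (intro borel_measurable_sum borel_measurable_times measurable_const; auto)+
  note [measurable] = meas[of "\<lambda>t. fst (c t)"] meas[of "\<lambda>t. snd (c t)"]
  interpret Q: prob_space Q unfolding Q_def by (rule NN.prob_space_axioms)
  have int: "integrable Q (\<lambda>p. ?A (fst p) * ?B (snd p))"
  proof (rule Q.integrable_const_bound[where B = 1])
    show "(\<lambda>p. ?A (fst p) * ?B (snd p)) \<in> borel_measurable Q" by measurable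
  qed (simp add: norm_mult)
  have u0: "(\<Sum>t\<in>J. r t * u t) = 0" for r using J u by (intro sum.neutral) auto
  let ?V = "\<lambda>r. complex_of_real (exp (- (\<Sum>s\<in>J. \<Sum>t\<in>J. r s * r t * \<gamma> s t) / 2))"
  have \<phi>: "(CLINT y|N. iexp (\<Sum>t\<in>J. r t * y t)) = ?V r" for r
    using drifted_gaussian_law_char[OF N J, of r] by (simp add: u0)
  have "(CLINT p|Q. iexp (\<Sum>t\<in>J. c t \<bullet> (fst p t, snd p t))) = (CLINT p|Q. ?A (fst p) * ?B (snd p))"
    unfolding e ..
  also have "\<dots> = (CLINT y|N. CLINT z|N. ?A y * ?B z)"
    using NN.integral_fst'[of "\<lambda>p. ?A (fst p) * ?B (snd p)"] int unfolding Q_def by simp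
  also have "\<dots> = ?V (\<lambda>t. fst (c t)) * ?V (\<lambda>t. snd (c t))"
    by (simp only: integral_mult_right_zero integral_mult_left_zero \<phi>)
  also have "\<dots> = complex_of_real (exp (- (\<Sum>s\<in>J. \<Sum>t\<in>J. (c s \<bullet> c t) * \<gamma> s t) / 2))"
  proof -
    have "(\<Sum>s\<in>J. \<Sum>t\<in>J. (c s \<bullet> c t) * \<gamma> s t)
      = (\<Sum>s\<in>J. \<Sum>t\<in>J. fst (c s) * fst (c t) * \<gamma> s t) + (\<Sum>s\<in>J. \<Sum>t\<in>J. snd (c s) * snd (c t) * \<gamma> s t)"
      by (simp add: inner_prod_def sum.distrib distrib_right)
    then show ?thesis by (simp add: exp_add[symmetric] add_divide_distrib flip: of_real_mult exp_add)
  qed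
  finally show ?thesis .
qed

text \<open>The map acts on each \<open>(y t, z t)\<close> by the reflection with matrix rows \<open>(\<alpha>, \<beta>)\<close> and
  \<open>(\<beta>, -\<alpha>)\<close>. Moving it to the coefficients of a linear functional leaves their inner products
  unchanged, so the characteristic functions of the pair are invariant.\<close>

lemma gaussian_pair_reflection:
  assumes u: "\<forall>t\<in>{0..T}. u t = 0" and orth: "\<alpha>\<^sup>2 + \<beta>\<^sup>2 = 1"
  defines "S \<equiv> \<lambda>p. (path_comb T \<alpha> \<beta> (fst p) (snd p), path_comb T \<beta> (- \<alpha>) (fst p) (snd p))"
  shows "S \<in> Q \<rightarrow>\<^sub>M Q" and "distr Q Q S = Q"
proof -
  let ?W = "path_space T \<Otimes>\<^sub>M path_space T"
  interpret Q: prob_space Q unfolding Q_def by (rule NN.prob_space_axioms)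
  have "S \<in> Q \<rightarrow>\<^sub>M ?W"
    unfolding S_def
    by (intro measurable_Pair measurable_path_comb gaussian_pair_measurable_fst gaussian_pair_measurable_snd)
  then show S: "S \<in> Q \<rightarrow>\<^sub>M Q"
    using measurable_cong_sets[OF refl sets_gaussian_pair] by blast
  have coord: "(\<lambda>p. (fst p t, snd p t)) \<in> borel_measurable Q" if "t \<in> {0..T}" for t
    using that unfolding borel_prod[symmetric]
    by (intro measurable_Pair measurable_compose[OF gaussian_pair_measurable_fst measurable_coordinate]
        measurable_compose[OF gaussian_pair_measurable_snd measurable_coordinate])
  show "distr Q Q S = Q"
  proof (rule measure_eqI_vector_family[where X = "\<lambda>t p. (fst p t, snd p t)" and I = "{0..T}"])
    show "finite_measure (distr Q Q S)" using S by (rule Q.finite_measure_distr)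
    show "finite_measure Q" by unfold_locales
    show "(\<lambda>p. (fst p t, snd p t)) \<in> borel_measurable (distr Q Q S)" if "t \<in> {0..T}" for t
      using coord[OF that] by simp
    show "sets (distr Q Q S) \<subseteq> sets M'"
      if "space M' = space (distr Q Q S)" "\<And>t. t \<in> {0..T} \<Longrightarrow> (\<lambda>p. (fst p t, snd p t)) \<in> borel_measurable M'" for M'
      using sets_pair_path_space_least[of M' T] that sets_gaussian_pair sets_eq_imp_space_eq[OF sets_gaussian_pair]
      by simp
    fix J and c :: "real \<Rightarrow> real \<times> real" assume J: "finite J" "J \<subseteq> {0..T}"
    define c' where "c' t = (\<alpha> * fst (c t) + \<beta> * snd (c t), \<beta> * fst (c t) - \<alpha> * snd (c t))" for t
    have iso: "c' s \<bullet> c' t = c s \<bullet> c t" for s t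
    proof -
      have "c' s \<bullet> c' t = (\<alpha>\<^sup>2 + \<beta>\<^sup>2) * (c s \<bullet> c t)"
        by (simp add: c'_def inner_prod_def power2_eq_square algebra_simps)
      then show ?thesis by (simp add: orth)
    qed
    have "(\<lambda>p. \<Sum>t\<in>J. c t \<bullet> (fst p t, snd p t)) \<in> borel_measurable Q"
      using J coord by (intro borel_measurable_sum borel_measurable_inner measurable_const) auto
    then have "(\<lambda>p. iexp (\<Sum>t\<in>J. c t \<bullet> (fst p t, snd p t))) \<in> borel_measurable Q" by measurable
    then have "(CLINT p|distr Q Q S. iexp (\<Sum>t\<in>J. c t \<bullet> (fst p t, snd p t)))
      = (CLINT p|Q. iexp (\<Sum>t\<in>J. c t \<bullet> (fst (S p) t, snd (S p) t)))"
      by (rule integral_distr[OF S])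
    also have "\<dots> = (CLINT p|Q. iexp (\<Sum>t\<in>J. c' t \<bullet> (fst p t, snd p t)))"
    proof (rule Bochner_Integration.integral_cong[OF refl])
      fix p :: "(real \<Rightarrow> real) \<times> (real \<Rightarrow> real)"
      have "c t \<bullet> (fst (S p) t, snd (S p) t) = c' t \<bullet> (fst p t, snd p t)" if "t \<in> J" for t
      proof -
        have "t \<in> {0..T}" using that J by blast
        then show ?thesis
          by (simp add: S_def c'_def inner_prod_def path_comb_apply algebra_simps)
      qed
      then show "iexp (\<Sum>t\<in>J. c t \<bullet> (fst (S p) t, snd (S p) t)) = iexp (\<Sum>t\<in>J. c' t \<bullet> (fst p t, snd p t))"
        by simp
    qed
    also have "\<dots> = (CLINT p|Q. iexp (\<Sum>t\<in>J. c t \<bullet> (fst p t, snd p t)))"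
      unfolding gaussian_pair_char[OF u J] iso ..
    finally show "(CLINT p|distr Q Q S. iexp (\<Sum>t\<in>J. c t \<bullet> (fst p t, snd p t)))
      = (CLINT p|Q. iexp (\<Sum>t\<in>J. c t \<bullet> (fst p t, snd p t)))" .
  qed simp
qed

lemma gaussian_pair_second_moment:
  assumes u: "\<forall>t\<in>{0..T}. u t = 0" and t: "t \<in> {0..T}"
  shows "(\<integral>\<^sup>+p. ennreal ((snd p t - a * fst p t)\<^sup>2) \<partial>Q) = ennreal ((1 + a\<^sup>2) * \<gamma> t t)"
proof -
  note gp = drifted_gaussian_law_basics(4)[OF N]
  have nn: "0 \<le> \<gamma> t t" by (rule centered_gaussian_process_variance_nonneg[OF gp t])
  note [measurable] = measurable_compose[OF gaussian_pair_measurable_fst measurable_coordinate[OF t]]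
    measurable_compose[OF gaussian_pair_measurable_snd measurable_coordinate[OF t]]
  have [measurable]: "(\<lambda>z. z t) \<in> borel_measurable N"
    using measurable_coordinate[OF t] measurable_cong_sets[OF drifted_gaussian_law_basics(2)[OF N] refl] by blast
  have "(\<lambda>p. ennreal ((snd p t - a * fst p t)\<^sup>2)) \<in> borel_measurable (N \<Otimes>\<^sub>M N)"
    unfolding Q_def[symmetric] by measurable
  from NN.nn_integral_snd[OF this]
  have "(\<integral>\<^sup>+p. ennreal ((snd p t - a * fst p t)\<^sup>2) \<partial>Q) = (\<integral>\<^sup>+z. (\<integral>\<^sup>+y. ennreal ((z t - a * y t)\<^sup>2) \<partial>N) \<partial>N)"
    unfolding Q_def by simp
  also have "\<dots> = (\<integral>\<^sup>+z. ennreal ((z t)\<^sup>2) + ennreal (a\<^sup>2 * \<gamma> t t) \<partial>N)"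
    using centered_gaussian_process_second_moment[OF gp t] nn bspec[OF u t] by (simp flip: ennreal_plus)
  also have "\<dots> = (\<integral>\<^sup>+z. ennreal ((z t)\<^sup>2) \<partial>N) + ennreal (a\<^sup>2 * \<gamma> t t)"
    by (subst nn_integral_add) (auto simp: N.emeasure_space_1)
  also have "(\<integral>\<^sup>+z. ennreal ((z t)\<^sup>2) \<partial>N) = ennreal (\<gamma> t t)"
    using centered_gaussian_process_second_moment[OF gp t, of 0 1] bspec[OF u t] by simp
  finally show ?thesis
    using nn by (simp add: distrib_right flip: ennreal_plus)
qed

end

section \<open>Risk of estimators\<close>

text \<open>The observed path and the drift both depend measurably on a parameter \<open>x\<close>; joint measurability
  in \<open>x\<close> and \<open>t\<close> is what permits the exchange of integrals below.\<close>

lemma measurable_squared_loss: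
  assumes \<xi>: "\<xi> \<in> estimators T" and sets: "sets \<mu> = sets (restrict_space borel {0..T})"
    and f: "f \<in> M \<rightarrow>\<^sub>M path_space T" and g: "g \<in> M \<rightarrow>\<^sub>M path_space T"
  shows "(\<lambda>(x, t). ennreal (\<bar>\<xi> t (f x) - g x t\<bar>\<^sup>2)) \<in> borel_measurable (M \<Otimes>\<^sub>M \<mu>)"
proof -
  have t: "snd \<in> M \<Otimes>\<^sub>M \<mu> \<rightarrow>\<^sub>M restrict_space borel {0..T}"
    using measurable_cong_sets[OF refl sets] measurable_snd by blast
  have eval: "(\<lambda>p. (snd p, h (fst p))) \<in> M \<Otimes>\<^sub>M \<mu> \<rightarrow>\<^sub>M restrict_space borel {0..T} \<Otimes>\<^sub>M path_space T"
    if "h \<in> M \<rightarrow>\<^sub>M path_space T" for h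
    using that t by (intro measurable_Pair measurable_compose[OF measurable_fst])
  have "(\<lambda>(t, \<omega>). \<xi> t \<omega>) \<in> borel_measurable (restrict_space borel {0..T} \<Otimes>\<^sub>M path_space T)"
    using \<xi> by (simp add: estimators_def)
  from measurable_compose[OF eval[OF f] this]
  have "(\<lambda>p. \<xi> (snd p) (f (fst p))) \<in> borel_measurable (M \<Otimes>\<^sub>M \<mu>)" by simp
  moreover have "(\<lambda>p. g (fst p) (snd p)) \<in> borel_measurable (M \<Otimes>\<^sub>M \<mu>)"
    using measurable_compose[OF eval[OF g] measurable_coordinate_process] by simp
  ultimately show ?thesis by (simp add: case_prod_beta')
qed

lemma coordinate_estimator_in_estimators: "coordinate_estimator \<in> estimators T"
  unfolding estimators_def mem_Collect_eq coordinate_estimator_def by (rule measurable_coordinate_process)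

lemma quadratic_risk_coordinate_estimator:
  assumes M: "drifted_gaussian_law T \<gamma> v M" and v: "v \<in> space (path_space T)"
    and \<mu>: "finite_measure \<mu>" "sets \<mu> = sets (restrict_space borel {0..T})"
  shows "quadratic_risk M \<mu> coordinate_estimator v = (\<integral>\<^sup>+t. ennreal (\<gamma> t t) \<partial>\<mu>)"
proof -
  note Mb = drifted_gaussian_law_basics[OF M]
  interpret M: prob_space M by (rule Mb)
  interpret \<mu>: finite_measure \<mu> by fact
  interpret M\<mu>: pair_sigma_finite M \<mu> ..
  have "space \<mu> = {0..T}" using sets_eq_imp_space_eq[OF \<mu>(2)] by (simp add: space_restrict_space)
  have "(\<lambda>(x, t). ennreal (\<bar>coordinate_estimator t x - v t\<bar>\<^sup>2)) \<in> borel_measurable (M \<Otimes>\<^sub>M \<mu>)"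
    using measurable_squared_loss[OF coordinate_estimator_in_estimators \<mu>(2), of "\<lambda>x. x" M "\<lambda>_. v"] v Mb(2)
    by (simp add: measurable_ident_sets)
  then have "quadratic_risk M \<mu> coordinate_estimator v
      = (\<integral>\<^sup>+t. (\<integral>\<^sup>+\<omega>. ennreal (\<bar>coordinate_estimator t \<omega> - v t\<bar>\<^sup>2) \<partial>M) \<partial>\<mu>)"
    unfolding quadratic_risk_def by (rule M\<mu>.Fubini'[symmetric])
  also have "\<dots> = (\<integral>\<^sup>+t. ennreal (\<gamma> t t) \<partial>\<mu>)"
  proof (rule nn_integral_cong)
    fix t assume "t \<in> space \<mu>"
    then have "t \<in> {0..T}" using \<open>space \<mu> = {0..T}\<close> by simp
    from centered_gaussian_process_second_moment[OF Mb(4) this, of 0 1]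
    show "(\<integral>\<^sup>+\<omega>. ennreal (\<bar>coordinate_estimator t \<omega> - v t\<bar>\<^sup>2) \<partial>M) = ennreal (\<gamma> t t)"
      by (simp add: coordinate_estimator_def power2_commute)
  qed
  finally show ?thesis .
qed

text \<open>The left-hand side is the integrated posterior variance for the prior \<open>a Z\<close>. The loss at \<open>(Y, Z)\<close>
  and at the reflected pair are averaged; since the observation is the same at both,
  \<open>(p - q)\<^sup>2 \<le> 2 ((x - p)\<^sup>2 + (x - q)\<^sup>2)\<close> removes the estimate \<open>x\<close>.\<close>

lemma bayes_risk_bound:
  assumes P: "\<And>v. v \<in> space (path_space T) \<Longrightarrow> drifted_gaussian_law T \<gamma> v (P v)"
    and \<mu>: "finite_measure \<mu>" "sets \<mu> = sets (restrict_space borel {0..T})"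
    and \<gamma>: "(\<lambda>t. \<gamma> t t) \<in> borel_measurable \<mu>"
    and \<xi>: "\<xi> \<in> estimators T"
  shows "ennreal (a\<^sup>2 / (1 + a\<^sup>2)) * (\<integral>\<^sup>+t. ennreal (\<gamma> t t) \<partial>\<mu>)
    \<le> (SUP v\<in>space (path_space T). quadratic_risk (P v) \<mu> \<xi> v)" (is "_ \<le> ?R")
proof -
  define u :: "real \<Rightarrow> real" where "u = (\<lambda>t\<in>{0..T}. 0)"
  have u: "u \<in> space (path_space T)"
  proof -
    have "continuous_on {0..T} u \<longleftrightarrow> continuous_on {0..T} (\<lambda>_. 0 :: real)"
      by (rule continuous_on_cong) (auto simp: u_def)
    then show ?thesis by (simp add: space_path_space u_def)
  qed
  have u0: "\<forall>t\<in>{0..T}. u t = 0" by (simp add: u_def)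
  define N where "N = P u"
  have N: "drifted_gaussian_law T \<gamma> u N" unfolding N_def by (rule P[OF u])
  note Nb = drifted_gaussian_law_basics[OF N]
  interpret N: prob_space N by (rule Nb)
  interpret NN: pair_prob_space N N ..
  interpret \<mu>: finite_measure \<mu> by fact
  have sp\<mu>: "space \<mu> = {0..T}" using sets_eq_imp_space_eq[OF \<mu>(2)] by (simp add: space_restrict_space)
  define Q where "Q = N \<Otimes>\<^sub>M N"
  interpret Q: prob_space Q unfolding Q_def by (rule NN.prob_space_axioms)
  interpret Q\<mu>: pair_sigma_finite Q \<mu> ..
  have fs: "fst \<in> Q \<rightarrow>\<^sub>M path_space T" "snd \<in> Q \<rightarrow>\<^sub>M path_space T"
    unfolding Q_def by (rule gaussian_pair_measurable_fst[OF N], rule gaussian_pair_measurable_snd[OF N])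
  \<comment> \<open>The reflection that fixes \<open>(1, a)\<close>; \<open>fix1\<close> and \<open>fix2\<close> say that it preserves \<open>y + a z\<close>.\<close>
  define \<alpha> \<beta> where "\<alpha> = (1 - a\<^sup>2) / (1 + a\<^sup>2)" and "\<beta> = 2 * a / (1 + a\<^sup>2)"
  have a1: "1 + a\<^sup>2 > 0" by (simp add: add_pos_nonneg)
  have orth: "\<alpha>\<^sup>2 + \<beta>\<^sup>2 = 1"
  proof -
    have "\<alpha>\<^sup>2 + \<beta>\<^sup>2 = ((1 - a\<^sup>2)\<^sup>2 + (2 * a)\<^sup>2) / (1 + a\<^sup>2)\<^sup>2"
      by (simp add: \<alpha>_def \<beta>_def power_divide add_divide_distrib)
    also have "(1 - a\<^sup>2)\<^sup>2 + (2 * a)\<^sup>2 = (1 + a\<^sup>2)\<^sup>2" by algebra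
    finally show ?thesis using a1 by simp
  qed
  have fix1: "\<alpha> + a * \<beta> = 1" and fix2: "\<beta> - a * \<alpha> = a" and flip: "1 + \<alpha> = 2 / (1 + a\<^sup>2)"
    using a1 by (simp_all add: \<alpha>_def \<beta>_def divide_simps) (simp_all add: power2_eq_square algebra_simps)
  define S where "S = (\<lambda>p. (path_comb T \<alpha> \<beta> (fst p) (snd p), path_comb T \<beta> (- \<alpha>) (fst p) (snd p)))"
  have S: "S \<in> Q \<rightarrow>\<^sub>M Q" "distr Q Q S = Q"
    unfolding S_def Q_def using gaussian_pair_reflection[OF N u0 orth] by auto
  \<comment> \<open>\<open>H (y, z)\<close> is the loss when the noise is \<open>y\<close> and the drift is \<open>a z\<close>.\<close>
  define drift where "drift z = path_comb T a 0 z z" for z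
  define obs where "obs p = path_comb T 1 a (fst p) (snd p)" for p
  define H where "H p = (\<integral>\<^sup>+t. ennreal (\<bar>\<xi> t (obs p) - drift (snd p) t\<bar>\<^sup>2) \<partial>\<mu>)" for p
  have meas_obs: "obs \<in> Q \<rightarrow>\<^sub>M path_space T" and meas_drift: "(\<lambda>p. drift (snd p)) \<in> Q \<rightarrow>\<^sub>M path_space T"
    unfolding obs_def drift_def
    by - (rule measurable_path_comb[OF fs], rule measurable_path_comb[OF fs(2) fs(2)])
  have meas_H: "H \<in> borel_measurable Q"
    unfolding H_def
    using \<mu>.borel_measurable_nn_integral[OF measurable_squared_loss[OF \<xi> \<mu>(2) meas_obs meas_drift]] by simp
  have "(\<integral>\<^sup>+p. H p \<partial>Q) = (\<integral>\<^sup>+z. (\<integral>\<^sup>+y. H (y, z) \<partial>N) \<partial>N)"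
    unfolding Q_def using meas_H by (intro NN.nn_integral_snd[symmetric]) (simp add: Q_def)
  also have "\<dots> \<le> (\<integral>\<^sup>+z. ?R \<partial>N)"
  proof (rule nn_integral_mono)
    fix z assume "z \<in> space N"
    then have z: "z \<in> space (path_space T)" using Nb by simp
    then have dz: "drift z \<in> space (path_space T)" unfolding drift_def by (intro path_comb_in_path_space)
    have Pz: "P (drift z) = distr N (path_space T) (\<lambda>\<omega>. path_comb T 1 1 \<omega> (drift z))"
      by (rule drifted_gaussian_law_shift[OF P[OF dz] N u0 dz])
    have sh: "(\<lambda>\<omega>. path_comb T 1 1 \<omega> (drift z)) \<in> N \<rightarrow>\<^sub>M path_space T"
      using dz Nb(2) by (intro measurable_path_comb) (auto intro: measurable_ident_sets)
    have "(\<lambda>\<omega>. \<integral>\<^sup>+t. ennreal (\<bar>\<xi> t \<omega> - drift z t\<bar>\<^sup>2) \<partial>\<mu>) \<in> borel_measurable (path_space T)"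
      using \<mu>.borel_measurable_nn_integral[OF measurable_squared_loss[OF \<xi> \<mu>(2), of "\<lambda>x. x" "path_space T" "\<lambda>_. drift z"]] dz
      by simp
    then have "quadratic_risk (P (drift z)) \<mu> \<xi> (drift z)
      = (\<integral>\<^sup>+y. (\<integral>\<^sup>+t. ennreal (\<bar>\<xi> t (path_comb T 1 1 y (drift z)) - drift z t\<bar>\<^sup>2) \<partial>\<mu>) \<partial>N)"
      unfolding quadratic_risk_def Pz by (intro nn_integral_distr[OF sh]) simp
    also have "\<dots> = (\<integral>\<^sup>+y. H (y, z) \<partial>N)"
    proof -
      have "path_comb T 1 1 y (drift z) = obs (y, z)" for y
        by (auto simp: path_comb_def drift_def obs_def)
      then show ?thesis by (simp add: H_def)
    qed
    finally show "(\<integral>\<^sup>+y. H (y, z) \<partial>N) \<le> ?R"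
      using SUP_upper[OF dz, of "\<lambda>v. quadratic_risk (P v) \<mu> \<xi> v"] by simp
  qed
  also have "\<dots> = ?R" by (simp add: N.emeasure_space_1)
  finally have avg: "(\<integral>\<^sup>+p. H p \<partial>Q) \<le> ?R" .
  have "(\<integral>\<^sup>+p. H p \<partial>Q) = (\<integral>\<^sup>+p. H (S p) \<partial>Q)"
    using nn_integral_distr[OF S(1), of H] meas_H S(2) by simp
  then have "2 * (\<integral>\<^sup>+p. H p \<partial>Q) = (\<integral>\<^sup>+p. H p \<partial>Q) + (\<integral>\<^sup>+p. H (S p) \<partial>Q)"
    by (simp add: mult_2)
  also have "\<dots> = (\<integral>\<^sup>+p. H p + H (S p) \<partial>Q)"
    using meas_H measurable_compose[OF S(1) meas_H] by (intro nn_integral_add[symmetric])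
  also have "\<dots> \<ge> (\<integral>\<^sup>+p. (\<integral>\<^sup>+t. ennreal (2 * a\<^sup>2 / (1 + a\<^sup>2)\<^sup>2) * ennreal ((snd p t - a * fst p t)\<^sup>2) \<partial>\<mu>) \<partial>Q)"
  proof (rule nn_integral_mono)
    fix p assume p: "p \<in> space Q"
    have obsS: "obs (S p) = obs p"
    proof
      fix t
      have "(\<alpha> * y + \<beta> * z) + a * (\<beta> * y - \<alpha> * z) = (\<alpha> + a * \<beta>) * y + (\<beta> - a * \<alpha>) * z" for y z
        by (simp add: algebra_simps)
      then show "obs (S p) t = obs p t"
        by (simp add: obs_def S_def path_comb_def fix1 fix2)
    qed
    have loss: "(\<lambda>t. ennreal (\<bar>\<xi> t (obs p) - drift (snd q) t\<bar>\<^sup>2)) \<in> borel_measurable \<mu>"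
      if "q \<in> space Q" for q
      using measurable_Pair2[OF measurable_squared_loss[OF \<xi> \<mu>(2), of "\<lambda>_. obs p" "count_space UNIV" "\<lambda>_. drift (snd q)"], of "()"]
        measurable_space[OF meas_obs p] measurable_space[OF meas_drift that] by simp
    have "H p + H (S p) = (\<integral>\<^sup>+t. ennreal (\<bar>\<xi> t (obs p) - drift (snd p) t\<bar>\<^sup>2)
        + ennreal (\<bar>\<xi> t (obs p) - drift (snd (S p)) t\<bar>\<^sup>2) \<partial>\<mu>)"
      unfolding H_def obsS using loss p measurable_space[OF S(1) p] by (intro nn_integral_add[symmetric]) auto
    also have "\<dots> \<ge> (\<integral>\<^sup>+t. ennreal (2 * a\<^sup>2 / (1 + a\<^sup>2)\<^sup>2) * ennreal ((snd p t - a * fst p t)\<^sup>2) \<partial>\<mu>)"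
    proof (rule nn_integral_mono)
      fix t assume "t \<in> space \<mu>"
      then have t: "t \<in> {0..T}" using sp\<mu> by simp
      define x y z where "x = \<xi> t (obs p)" and "y = fst p t" and "z = snd p t"
      have d: "drift (snd p) t = a * z" "drift (snd (S p)) t = a * (\<beta> * y - \<alpha> * z)"
        using t by (simp_all add: drift_def S_def path_comb_apply y_def z_def)
      have "a * z - a * (\<beta> * y - \<alpha> * z) = a * ((1 + \<alpha>) * z - \<beta> * y)" by (simp add: algebra_simps)
      also have "\<dots> = 2 * a / (1 + a\<^sup>2) * (z - a * y)"
        by (simp add: flip \<beta>_def) (simp add: diff_divide_distrib algebra_simps)
      finally have "(a * z - a * (\<beta> * y - \<alpha> * z))\<^sup>2 = (2 * a / (1 + a\<^sup>2))\<^sup>2 * (z - a * y)\<^sup>2"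
        by (simp only: power_mult_distrib)
      moreover have "(a * z - a * (\<beta> * y - \<alpha> * z))\<^sup>2 \<le> 2 * ((x - a * z)\<^sup>2 + (x - a * (\<beta> * y - \<alpha> * z))\<^sup>2)"
        using zero_le_power2[of "(x - a * z) + (x - a * (\<beta> * y - \<alpha> * z))"]
        by (simp add: power2_eq_square algebra_simps)
      ultimately have "2 * a\<^sup>2 / (1 + a\<^sup>2)\<^sup>2 * (z - a * y)\<^sup>2 \<le> (x - a * z)\<^sup>2 + (x - a * (\<beta> * y - \<alpha> * z))\<^sup>2"
        by (simp add: power_divide power_mult_distrib)
      then show "ennreal (2 * a\<^sup>2 / (1 + a\<^sup>2)\<^sup>2) * ennreal ((snd p t - a * fst p t)\<^sup>2)
        \<le> ennreal (\<bar>\<xi> t (obs p) - drift (snd p) t\<bar>\<^sup>2) + ennreal (\<bar>\<xi> t (obs p) - drift (snd (S p)) t\<bar>\<^sup>2)"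
        unfolding d by (simp add: x_def y_def z_def flip: ennreal_mult ennreal_plus)
    qed
    finally show "(\<integral>\<^sup>+t. ennreal (2 * a\<^sup>2 / (1 + a\<^sup>2)\<^sup>2) * ennreal ((snd p t - a * fst p t)\<^sup>2) \<partial>\<mu>) \<le> H p + H (S p)" .
  qed
  also have "(\<integral>\<^sup>+p. (\<integral>\<^sup>+t. ennreal (2 * a\<^sup>2 / (1 + a\<^sup>2)\<^sup>2) * ennreal ((snd p t - a * fst p t)\<^sup>2) \<partial>\<mu>) \<partial>Q)
    = (\<integral>\<^sup>+t. (\<integral>\<^sup>+p. ennreal (2 * a\<^sup>2 / (1 + a\<^sup>2)\<^sup>2) * ennreal ((snd p t - a * fst p t)\<^sup>2) \<partial>Q) \<partial>\<mu>)"
  proof (rule Q\<mu>.Fubini'[symmetric])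
    have "(\<lambda>(p, t). ennreal (\<bar>coordinate_estimator t (snd p) - path_comb T a 0 (fst p) (fst p) t\<bar>\<^sup>2)) \<in> borel_measurable (Q \<Otimes>\<^sub>M \<mu>)"
      by (rule measurable_squared_loss[OF coordinate_estimator_in_estimators \<mu>(2) fs(2)
            measurable_path_comb[OF fs(1) fs(1)]])
    also have "?this \<longleftrightarrow> (\<lambda>(p, t). ennreal ((snd p t - a * fst p t)\<^sup>2)) \<in> borel_measurable (Q \<Otimes>\<^sub>M \<mu>)"
      by (intro measurable_cong) (auto simp: space_pair_measure sp\<mu> coordinate_estimator_def path_comb_apply)
    finally show "(\<lambda>(p, t). ennreal (2 * a\<^sup>2 / (1 + a\<^sup>2)\<^sup>2) * ennreal ((snd p t - a * fst p t)\<^sup>2)) \<in> borel_measurable (Q \<Otimes>\<^sub>M \<mu>)"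
      by (simp add: case_prod_beta')
  qed
  also have "\<dots> = (\<integral>\<^sup>+t. ennreal (2 * (a\<^sup>2 / (1 + a\<^sup>2))) * ennreal (\<gamma> t t) \<partial>\<mu>)"
  proof (rule nn_integral_cong)
    fix t assume "t \<in> space \<mu>"
    then have t: "t \<in> {0..T}" using sp\<mu> by simp
    have nn: "0 \<le> \<gamma> t t" by (rule centered_gaussian_process_variance_nonneg[OF Nb(4) t])
    have m: "(\<lambda>p. ennreal ((snd p t - a * fst p t)\<^sup>2)) \<in> borel_measurable Q"
    proof -
      note [measurable] = measurable_compose[OF fs(1) measurable_coordinate[OF t]]
        measurable_compose[OF fs(2) measurable_coordinate[OF t]]
      show ?thesis by measurable
    qed
    have "(\<integral>\<^sup>+p. ennreal (2 * a\<^sup>2 / (1 + a\<^sup>2)\<^sup>2) * ennreal ((snd p t - a * fst p t)\<^sup>2) \<partial>Q)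
      = ennreal (2 * a\<^sup>2 / (1 + a\<^sup>2)\<^sup>2) * ennreal ((1 + a\<^sup>2) * \<gamma> t t)"
      using nn_integral_cmult[OF m] gaussian_pair_second_moment[OF N u0 t, of a] by (simp add: Q_def)
    also have "\<dots> = ennreal (2 * a\<^sup>2 / (1 + a\<^sup>2)\<^sup>2 * ((1 + a\<^sup>2) * \<gamma> t t))"
      using nn a1 by (intro ennreal_mult[symmetric]) auto
    also have "2 * a\<^sup>2 / (1 + a\<^sup>2)\<^sup>2 * ((1 + a\<^sup>2) * \<gamma> t t) = 2 * (a\<^sup>2 / (1 + a\<^sup>2)) * \<gamma> t t"
      using a1 by (simp add: power2_eq_square[of "1 + a\<^sup>2"])
    also have "ennreal \<dots> = ennreal (2 * (a\<^sup>2 / (1 + a\<^sup>2))) * ennreal (\<gamma> t t)"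
      using nn a1 by (intro ennreal_mult) auto
    finally show "(\<integral>\<^sup>+p. ennreal (2 * a\<^sup>2 / (1 + a\<^sup>2)\<^sup>2) * ennreal ((snd p t - a * fst p t)\<^sup>2) \<partial>Q)
      = ennreal (2 * (a\<^sup>2 / (1 + a\<^sup>2))) * ennreal (\<gamma> t t)" .
  qed
  finally have "(\<integral>\<^sup>+t. ennreal (2 * (a\<^sup>2 / (1 + a\<^sup>2))) * ennreal (\<gamma> t t) \<partial>\<mu>) \<le> 2 * (\<integral>\<^sup>+p. H p \<partial>Q)" .
  also have "(\<integral>\<^sup>+t. ennreal (2 * (a\<^sup>2 / (1 + a\<^sup>2))) * ennreal (\<gamma> t t) \<partial>\<mu>)
      = ennreal (2 * (a\<^sup>2 / (1 + a\<^sup>2))) * (\<integral>\<^sup>+t. ennreal (\<gamma> t t) \<partial>\<mu>)"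
    using \<gamma> by (intro nn_integral_cmult) auto
  also have "ennreal (2 * (a\<^sup>2 / (1 + a\<^sup>2))) = 2 * ennreal (a\<^sup>2 / (1 + a\<^sup>2))"
    using a1 by (subst ennreal_mult) auto
  finally have "ennreal (a\<^sup>2 / (1 + a\<^sup>2)) * (\<integral>\<^sup>+t. ennreal (\<gamma> t t) \<partial>\<mu>) \<le> (\<integral>\<^sup>+p. H p \<partial>Q)"
    by (simp add: mult.assoc ennreal_mult_le_mult_iff)
  with avg show ?thesis by (rule order_trans[rotated])
qed

text \<open>The prior is made uninformative: \<open>a\<^sup>2 / (1 + a\<^sup>2)\<close> tends to \<open>1\<close> as \<open>a\<close> tends to infinity.\<close>

lemma minimax_lower_bound:
  assumes P: "\<And>v. v \<in> space (path_space T) \<Longrightarrow> drifted_gaussian_law T \<gamma> v (P v)"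
    and \<mu>: "finite_measure \<mu>" "sets \<mu> = sets (restrict_space borel {0..T})"
    and \<gamma>: "integrable \<mu> (\<lambda>t. \<gamma> t t)"
    and \<xi>: "\<xi> \<in> estimators T"
  shows "(\<integral>\<^sup>+t. ennreal (\<gamma> t t) \<partial>\<mu>) \<le> (SUP v\<in>space (path_space T). quadratic_risk (P v) \<mu> \<xi> v)"
proof (rule LIMSEQ_le_const2)
  let ?G = "\<integral>\<^sup>+t. ennreal (\<gamma> t t) \<partial>\<mu>"
  have "(\<lambda>n. (real n)\<^sup>2 / (1 + (real n)\<^sup>2)) \<longlonglongrightarrow> 1" by real_asymp
  then have "(\<lambda>n. ennreal ((real n)\<^sup>2 / (1 + (real n)\<^sup>2)) * ?G) \<longlonglongrightarrow> ennreal 1 * ?G"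
    using \<gamma> unfolding mult.commute[of _ ?G]
    by (intro ennreal_tendsto_cmult tendsto_ennrealI) (auto simp: real_integrable_def less_top)
  then show "(\<lambda>n. ennreal ((real n)\<^sup>2 / (1 + (real n)\<^sup>2)) * ?G) \<longlonglongrightarrow> ?G" by simp
qed (use bayes_risk_bound[OF P \<mu> borel_measurable_integrable[OF \<gamma>] \<xi>] in blast)

theorem proposition3p3:
  fixes T :: real
    and \<mu> :: "real measure"
    and K :: "real \<Rightarrow> real \<Rightarrow> real"
    and P :: "(real \<Rightarrow> real) \<Rightarrow> (real \<Rightarrow> real) measure"
  assumes "T > 0"
    and "finite_measure \<mu>"
    and "sets \<mu> = sets (restrict_space borel {0..T})"
    and "admissible_kernel T K"
    and "\<And>v. v \<in> space (path_space T) \<Longrightarrow> drifted_gaussian_law T (kernel_cov K) v (P v)"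
    and "integrable \<mu> (\<lambda>t. kernel_cov K t t)"
  shows "coordinate_estimator \<in> estimators T
    \<and> gaussian_risk T K \<mu> = (LINT t|\<mu>. kernel_cov K t t)
    \<and> (\<forall>u\<in>space (path_space T).
          ennreal (gaussian_risk T K \<mu>) = quadratic_risk (P u) \<mu> coordinate_estimator u
        \<and> quadratic_risk (P u) \<mu> coordinate_estimator u
            = (INF \<xi>\<in>estimators T. SUP v\<in>space (path_space T). quadratic_risk (P v) \<mu> \<xi> v))"
proof (intro conjI ballI)
  note P = assms(5)
  have sp\<mu>: "space \<mu> = {0..T}" using sets_eq_imp_space_eq[OF assms(3)] by (simp add: space_restrict_space)
  show "coordinate_estimator \<in> estimators T" by (rule coordinate_estimator_in_estimators)
  show gr: "gaussian_risk T K \<mu> = (LINT t|\<mu>. kernel_cov K t t)"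
    unfolding gaussian_risk_def using cm_inner_chi_Gamma_op[OF assms(4)] sp\<mu>
    by (intro Bochner_Integration.integral_cong) auto
  let ?G = "\<integral>\<^sup>+t. ennreal (kernel_cov K t t) \<partial>\<mu>"
  let ?risk = "\<lambda>\<xi> v. quadratic_risk (P v) \<mu> \<xi> v"
  have risk: "?risk coordinate_estimator v = ?G" if "v \<in> space (path_space T)" for v
    by (rule quadratic_risk_coordinate_estimator[OF P[OF that] that assms(2,3)])
  fix u assume u: "u \<in> space (path_space T)"
  have "0 \<le> kernel_cov K t t" if "t \<in> space \<mu>" for t
    using centered_gaussian_process_variance_nonneg[OF drifted_gaussian_law_basics(4)[OF P[OF u]]] that sp\<mu> by simp
  then have "?G = ennreal (LINT t|\<mu>. kernel_cov K t t)"
    by (intro nn_integral_eq_integral assms(6) AE_I2)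
  then show "ennreal (gaussian_risk T K \<mu>) = ?risk coordinate_estimator u"
    using gr risk[OF u] by simp
  have "(INF \<xi>\<in>estimators T. SUP v\<in>space (path_space T). ?risk \<xi> v)
      \<le> (SUP v\<in>space (path_space T). ?risk coordinate_estimator v)"
    by (rule INF_lower[OF coordinate_estimator_in_estimators])
  also have "\<dots> \<le> ?G" using risk by (intro SUP_least) simp
  finally have "(INF \<xi>\<in>estimators T. SUP v\<in>space (path_space T). ?risk \<xi> v) \<le> ?G" .
  moreover have "?G \<le> (INF \<xi>\<in>estimators T. SUP v\<in>space (path_space T). ?risk \<xi> v)"
    by (intro INF_greatest minimax_lower_bound[OF P assms(2,3,6)])
  ultimately show "?risk coordinate_estimator u
      = (INF \<xi>\<in>estimators T. SUP v\<in>space (path_space T). ?risk \<xi> v)"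
    using risk[OF u] by simp
qed

end
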